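(* Let $n\ge 1$ be an integer. (1) The algebra $\Sigma_n$ has a basis (as a vector space over $F$) formed by special elements, i.e. by the images in $\Sigma_n$ of special permutations of $S_n$. (2) Over $F=\mathbb{C}$, the space $\Sigma_n^+$ of symmetric elements of $\Sigma_n$ has a basis over $\mathbb{C}$ formed by (images of) involutions of $S_n$. (3) The space of real and symmetric elements of $\Sigma_n$ has a basis over $\mathbb{R}$ formed by (images of) involutions of $S_n$.
   Context: Let $F$ be the field $\mathbb{Q}$ or $\mathbb{C}$ and let $V$ be a vector space over $F$ with $\dim V=2$. The symmetric group $S_n$ acts on $V^{\otimes n}$ by permuting the tensor factors, and $\Sigma_n\subset \mathrm{End}(V^{\otimes n})$ denotes the $F$-algebra of operators generated (equivalently, linearly spanned) by these permutation operators, i.e. the image of the group algebra $F[S_n]\to \mathrm{End}(V^{\otimes n})$. A permutation is identified with its image in $\Sigma_n$ when speaking of elements of $\Sigma_n$. The map $g\mapsto g^{-1}$ on $S_n$, extended $F$-linearly to $F[S_n]$, induces an $F$-linear anti-automorphism of order at most two of $\Sigma_n$. An element of $\Sigma_n$ is symmetric if it is fixed by this map, and $\Sigma_n^+$ is the subspace of symmetric elements. For $F=\mathbb{C}$, the real elements of $\Sigma_n$ are those in the $\mathbb{R}$-linear span of the permutation operators; the real and symmetric elements are the real elements fixed by the $\mathbb{C}$-linear anti-automorphism of $\Sigma_n$ induced by $g\mapsto g^{-1}$. An involution of $S_n$ is a permutation all of whose cycles have length $1$ or $2$ (the identity is included). A special permutation of $S_n$ is a permutation which is either an involution, or has exactly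 one cycle of length $3$ and all its other cycles of length $1$ or $2$. *)

theory Defs
  imports
    Complex_Main
    "HOL-Library.Function_Algebras"
    "HOL-Combinatorics.Permutations"
    "HOL-Combinatorics.Orbits"
begin

section \<open>Special permutations\<close>

text \<open>The symmetric group on n letters consists of the functions \<open>nat \<Rightarrow> nat\<close> that permute
  \<open>{1..n}\<close> (and hence fix every other number).\<close>

definition sym_group :: "nat \<Rightarrow> (nat \<Rightarrow> nat) set" where
  "sym_group n = {g. g permutes {1..n}}"

definition perm_cycles :: "nat \<Rightarrow> (nat \<Rightarrow> nat) \<Rightarrow> nat set set" where
  "perm_cycles n g = orbit g ` {1..n}"

definition is_involution :: "nat \<Rightarrow> (nat \<Rightarrow> nat) \<Rightarrow> bool" where
  "is_involution n g \<longleftrightarrow>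
     g \<in> sym_group n \<and> (\<forall>C\<in>perm_cycles n g. card C = 1 \<or> card C = 2)"

definition is_special :: "nat \<Rightarrow> (nat \<Rightarrow> nat) \<Rightarrow> bool" where
  "is_special n g \<longleftrightarrow>
     is_involution n g \<or>
     (g \<in> sym_group n \<and>
      (\<exists>!C. C \<in> perm_cycles n g \<and> card C = 3) \<and>
      (\<forall>C\<in>perm_cycles n g. card C = 3 \<or> card C = 1 \<or> card C = 2))"


section \<open>Tensor powers of a vector space\<close>

text \<open>An n-tuple of vectors is a function \<open>v :: nat \<Rightarrow> 'v\<close> of which only the values on
  \<open>{1..n}\<close> are relevant.\<close>

definition multilinear_map ::
  "nat \<Rightarrow> ('f::field \<Rightarrow> 'v::ab_group_add \<Rightarrow> 'v) \<Rightarrow> ('f \<Rightarrow> 'w::ab_group_add \<Rightarrow> 'w) \<Rightarrow>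
    ((nat \<Rightarrow> 'v) \<Rightarrow> 'w) \<Rightarrow> bool" where
  "multilinear_map n sV sW m \<longleftrightarrow>
     (\<forall>v w. (\<forall>i\<in>{1..n}. v i = w i) \<longrightarrow> m v = m w) \<and>
     (\<forall>v. \<forall>i\<in>{1..n}. Vector_Spaces.linear sV sW (\<lambda>x. m (v(i := x))))"

text \<open>The vector space \<open>'t\<close> with scalar multiplication \<open>sT\<close>, together with the map
  \<open>\<tau> v = v 1 \<otimes> \<dots> \<otimes> v n\<close>, is the n-th tensor power of \<open>'v\<close>.
  A definition cannot quantify over the type of the target space, so the universal property is
  required for maps into the field only; the theorem \<open>universal\<close> below shows that it then holds
  for maps into every vector space.\<close>

locale tensor_power =
  V: vector_space sV + T: vector_space sT
  for n :: nat
    and sV :: "'f::field \<Rightarrow> 'v::ab_group_add \<Rightarrow> 'v"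
    and sT :: "'f \<Rightarrow> 't::ab_group_add \<Rightarrow> 't"
    and \<tau> :: "(nat \<Rightarrow> 'v) \<Rightarrow> 't" +
  assumes multilinear: "multilinear_map n sV sT \<tau>"
    and universal_form:
      "multilinear_map n sV (*) m \<Longrightarrow>
        \<exists>!h. Vector_Spaces.linear sT (*) h \<and> (\<forall>v. h (\<tau> v) = m v)"

lemma vector_space_mult: "vector_space ((*) :: 'f::field \<Rightarrow> 'f \<Rightarrow> 'f)"
  by unfold_locales (auto simp: algebra_simps)

lemma exists_functional:
  fixes s :: "'f::field \<Rightarrow> 'w::ab_group_add \<Rightarrow> 'w"
  assumes "vector_space s" and x: "x \<notin> module.span s S"
  shows "\<exists>h. Vector_Spaces.linear s (*) h \<and> h x = 1 \<and> (\<forall>y\<in>S. h y = 0)"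
proof -
  interpret W: vector_space s by fact
  interpret F: vector_space "(*) :: 'f \<Rightarrow> 'f \<Rightarrow> 'f" by (rule vector_space_mult)
  interpret P: vector_space_pair s "(*) :: 'f \<Rightarrow> 'f \<Rightarrow> 'f" by unfold_locales
  obtain B where B: "B \<subseteq> S" "W.independent B" "S \<subseteq> W.span B"
    using W.maximal_independent_subset by blast
  have "W.span B = W.span S"
    using B by (metis W.span_mono W.span_span subset_antisym)
  then have xB: "x \<notin> W.span B" using x by simp
  then have "W.independent (insert x B)"
    using B(2) by (simp add: W.independent_insertI)
  from P.linear_independent_extend[OF this, of "\<lambda>y. if y = x then 1 else 0"]
  obtain h where h: "Vector_Spaces.linear s (*) h"
    and hB: "\<And>y. y \<in> insert x B \<Longrightarrow> h y = (if y = x then 1 else 0)" by blast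
  have "h y = 0" if "y \<in> B" for y
    using hB[of y] that xB W.span_base by fastforce
  then have "h y = 0" if "y \<in> W.span B" for y
    using P.linear_eq_0_on_span[OF h, of B y] that by blast
  then show ?thesis using h hB[of x] B(3) by auto
qed

context tensor_power
begin

lemma span_pure: "T.span (range \<tau>) = UNIV"
proof (rule ccontr)
  interpret F: vector_space "(*) :: 'f \<Rightarrow> 'f \<Rightarrow> 'f" by (rule vector_space_mult)
  interpret P: vector_space_pair sT "(*) :: 'f \<Rightarrow> 'f \<Rightarrow> 'f" by unfold_locales
  interpret Q: vector_space_pair sV "(*) :: 'f \<Rightarrow> 'f \<Rightarrow> 'f" by unfold_locales
  assume "T.span (range \<tau>) \<noteq> UNIV"
  then obtain x where "x \<notin> T.span (range \<tau>)" by blast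
  from exists_functional[OF T.vector_space_axioms this]
  obtain h where h: "Vector_Spaces.linear sT (*) h" "h x = 1" "\<And>v. h (\<tau> v) = 0" by auto
  have "multilinear_map n sV (*) (\<lambda>_. 0 :: 'f)"
    unfolding multilinear_map_def using Q.linear_zero by auto
  then have "\<exists>!h. Vector_Spaces.linear sT (*) h \<and> (\<forall>v. h (\<tau> v) = 0)"
    by (rule universal_form)
  then have "h = (\<lambda>_. 0)" using h P.linear_zero by blast
  then show False using h(2) by simp
qed

theorem universal:
  fixes sW :: "'f \<Rightarrow> 'w::ab_group_add \<Rightarrow> 'w"
  assumes W: "vector_space sW" and m: "multilinear_map n sV sW m"
  shows "\<exists>!h. Vector_Spaces.linear sT sW h \<and> (\<forall>v. h (\<tau> v) = m v)"
proof -
  interpret W: vector_space sW by (rule W)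
  interpret F: vector_space "(*) :: 'f \<Rightarrow> 'f \<Rightarrow> 'f" by (rule vector_space_mult)
  interpret TW: vector_space_pair sT sW by unfold_locales
  interpret TF: vector_space_pair sT "(*) :: 'f \<Rightarrow> 'f \<Rightarrow> 'f" by unfold_locales
  obtain B where B: "B \<subseteq> range \<tau>" "T.independent B" "range \<tau> \<subseteq> T.span B"
    using T.maximal_independent_subset by blast
  have span_B: "T.span B = UNIV"
    using B span_pure by (metis T.span_minimal T.subspace_span top.extremum_uniqueI)
  define p where "p b = (SOME v. \<tau> v = b)" for b
  have p: "\<tau> (p b) = b" if "b \<in> B" for b
    unfolding p_def using B(1) that by (intro someI_ex[of "\<lambda>v. \<tau> v = b"]) blast
  from TW.linear_independent_extend[OF B(2), of "\<lambda>b. m (p b)"]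
  obtain h where h: "Vector_Spaces.linear sT sW h" and hB: "\<And>b. b \<in> B \<Longrightarrow> h b = m (p b)"
    by blast
  have "h (\<tau> v) = m v" for v
  proof (rule ccontr)
    assume "h (\<tau> v) \<noteq> m v"
    then have "h (\<tau> v) - m v \<notin> W.span {}" by simp
    from exists_functional[OF W this]
    obtain l where l: "Vector_Spaces.linear sW (*) l" "l (h (\<tau> v) - m v) = 1" by blast
    have "multilinear_map n sV (*) (\<lambda>v. l (m v))"
      using m l(1) Vector_Spaces.linear_compose[of sV sW _ "(*)" l]
      unfolding multilinear_map_def by (metis (no_types, lifting) comp_def ext)
    then obtain L where L: "Vector_Spaces.linear sT (*) L" "\<And>v. L (\<tau> v) = l (m v)"
      using universal_form by blast
    have lh: "Vector_Spaces.linear sT (*) (l \<circ> h)"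
      using h l(1) by (rule Vector_Spaces.linear_compose)
    have "(l \<circ> h) b = L b" if "b \<in> B" for b
      using hB[OF that] L(2)[of "p b"] p[OF that] by simp
    then have "(l \<circ> h) (\<tau> v) = L (\<tau> v)"
      using TF.linear_eq_on[OF lh L(1), of "\<tau> v" B] span_B by simp
    then have "l (h (\<tau> v)) = l (m v)" using L(2) by simp
    then show False
      using l(2) module_hom.diff[of sW "(*)" l] l(1)
      by (simp add: Vector_Spaces.linear_def)
  qed
  moreover have "g = h" if "Vector_Spaces.linear sT sW g" "\<And>v. g (\<tau> v) = m v" for g
  proof
    fix x
    have "g y = h y" if "y \<in> range \<tau>" for y
      using that \<open>\<And>v. g (\<tau> v) = m v\<close> \<open>\<And>v. h (\<tau> v) = m v\<close> by auto
    then show "g x = h x"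
      using TW.linear_eq_on[OF \<open>Vector_Spaces.linear sT sW g\<close> h, of x "range \<tau>"] span_pure
      by simp
  qed
  ultimately show ?thesis using h by blast
qed

end


section \<open>The algebra spanned by the permutation operators\<close>

text \<open>The action of \<open>g\<close> on the tensor power:
  \<open>v 1 \<otimes> \<dots> \<otimes> v n \<mapsto> v (inv g 1) \<otimes> \<dots> \<otimes> v (inv g n)\<close>.\<close>

definition perm_op ::
  "('f::field \<Rightarrow> 't::ab_group_add \<Rightarrow> 't) \<Rightarrow> ((nat \<Rightarrow> 'v) \<Rightarrow> 't) \<Rightarrow> (nat \<Rightarrow> nat) \<Rightarrow> 't \<Rightarrow> 't" where
  "perm_op sT \<tau> g =
     (THE A. Vector_Spaces.linear sT sT A \<and> (\<forall>v. A (\<tau> v) = \<tau> (v \<circ> inv g)))"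

lemma (in tensor_power) perm_op:
  assumes g: "g \<in> sym_group n"
  shows "Vector_Spaces.linear sT sT (perm_op sT \<tau> g)"
    and "perm_op sT \<tau> g (\<tau> v) = \<tau> (v \<circ> inv g)"
proof -
  have gp: "g permutes {1..n}" using g by (simp add: sym_group_def)
  have ip: "inv g permutes {1..n}" using gp by (rule permutes_inv)
  have upd: "(v(i := x)) \<circ> inv g = (v \<circ> inv g)(g i := x)" for v :: "nat \<Rightarrow> 'v" and i x
    using permutes_inverses[OF gp] by (auto simp: fun_eq_iff)
  have "multilinear_map n sV sT (\<lambda>v. \<tau> (v \<circ> inv g))"
    unfolding multilinear_map_def
  proof (intro conjI allI ballI impI)
    fix v w :: "nat \<Rightarrow> 'v"
    assume "\<forall>i\<in>{1..n}. v i = w i"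
    then have "\<forall>i\<in>{1..n}. (v \<circ> inv g) i = (w \<circ> inv g) i"
      using permutes_in_image[OF ip] by simp
    then show "\<tau> (v \<circ> inv g) = \<tau> (w \<circ> inv g)"
      using multilinear by (auto simp: multilinear_map_def)
  next
    fix v :: "nat \<Rightarrow> 'v" and i
    assume "i \<in> {1..n}"
    then have "g i \<in> {1..n}" using permutes_in_image[OF gp] by blast
    then show "Vector_Spaces.linear sV sT (\<lambda>x. \<tau> ((v(i := x)) \<circ> inv g))"
      using multilinear unfolding upd by (auto simp: multilinear_map_def)
  qed
  from theI'[OF universal[OF T.vector_space_axioms this]]
  show "Vector_Spaces.linear sT sT (perm_op sT \<tau> g)"
    and "perm_op sT \<tau> g (\<tau> v) = \<tau> (v \<circ> inv g)"
    unfolding perm_op_def by auto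
qed

definition op_scale :: "('f \<Rightarrow> 't \<Rightarrow> 't) \<Rightarrow> 'f \<Rightarrow> ('t \<Rightarrow> 't) \<Rightarrow> 't \<Rightarrow> 't" where
  "op_scale sT c A = (\<lambda>x. sT c (A x))"

definition real_op_scale :: "(complex \<Rightarrow> 't \<Rightarrow> 't) \<Rightarrow> real \<Rightarrow> ('t \<Rightarrow> 't) \<Rightarrow> 't \<Rightarrow> 't" where
  "real_op_scale sT r = op_scale sT (complex_of_real r)"

definition perm_algebra ::
  "nat \<Rightarrow> ('f::field \<Rightarrow> 't::ab_group_add \<Rightarrow> 't) \<Rightarrow> ((nat \<Rightarrow> 'v) \<Rightarrow> 't) \<Rightarrow> ('t \<Rightarrow> 't) set" where
  "perm_algebra n sT \<tau> = module.span (op_scale sT) (perm_op sT \<tau> ` sym_group n)"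

text \<open>The image of an element \<open>a\<close> of the group algebra, given by its coefficients.\<close>

definition group_algebra_op ::
  "nat \<Rightarrow> ('f::field \<Rightarrow> 't::ab_group_add \<Rightarrow> 't) \<Rightarrow> ((nat \<Rightarrow> 'v) \<Rightarrow> 't) \<Rightarrow>
    ((nat \<Rightarrow> nat) \<Rightarrow> 'f) \<Rightarrow> 't \<Rightarrow> 't" where
  "group_algebra_op n sT \<tau> a = (\<Sum>g\<in>sym_group n. op_scale sT (a g) (perm_op sT \<tau> g))"

text \<open>The linear map on \<open>perm_algebra\<close> induced by \<open>g \<mapsto> inv g\<close>: it sends the image of \<open>a\<close> to
  the image of \<open>\<lambda>g. a (inv g)\<close>. It is well defined because the kernel of the group algebra
  acting on the tensor power is stable under \<open>g \<mapsto> inv g\<close>, so the choice of \<open>a\<close> is immaterial.\<close>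

definition inverse_map ::
  "nat \<Rightarrow> ('f::field \<Rightarrow> 't::ab_group_add \<Rightarrow> 't) \<Rightarrow> ((nat \<Rightarrow> 'v) \<Rightarrow> 't) \<Rightarrow> ('t \<Rightarrow> 't) \<Rightarrow> 't \<Rightarrow> 't" where
  "inverse_map n sT \<tau> A =
     (let a = SOME a. group_algebra_op n sT \<tau> a = A
      in group_algebra_op n sT \<tau> (\<lambda>g. a (inv g)))"

definition symmetric_elements ::
  "nat \<Rightarrow> ('f::field \<Rightarrow> 't::ab_group_add \<Rightarrow> 't) \<Rightarrow> ((nat \<Rightarrow> 'v) \<Rightarrow> 't) \<Rightarrow> ('t \<Rightarrow> 't) set" where
  "symmetric_elements n sT \<tau> = {A \<in> perm_algebra n sT \<tau>. inverse_map n sT \<tau> A = A}"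

definition real_elements ::
  "nat \<Rightarrow> (complex \<Rightarrow> 't::ab_group_add \<Rightarrow> 't) \<Rightarrow> ((nat \<Rightarrow> 'v) \<Rightarrow> 't) \<Rightarrow> ('t \<Rightarrow> 't) set" where
  "real_elements n sT \<tau> = module.span (real_op_scale sT) (perm_op sT \<tau> ` sym_group n)"

definition real_symmetric_elements ::
  "nat \<Rightarrow> (complex \<Rightarrow> 't::ab_group_add \<Rightarrow> 't) \<Rightarrow> ((nat \<Rightarrow> 'v) \<Rightarrow> 't) \<Rightarrow> ('t \<Rightarrow> 't) set" where
  "real_symmetric_elements n sT \<tau> = {A \<in> real_elements n sT \<tau>. inverse_map n sT \<tau> A = A}"

definition is_basis ::
  "('f::field \<Rightarrow> 'w::ab_group_add \<Rightarrow> 'w) \<Rightarrow> 'w set \<Rightarrow> 'w set \<Rightarrow> bool" where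
  "is_basis s B W \<longleftrightarrow> \<not> module.dependent s B \<and> module.span s B = W"

lemma vector_space_op_scale:
  assumes "vector_space sT" shows "vector_space (op_scale sT)"
proof -
  interpret vector_space sT by fact
  show ?thesis
    by unfold_locales (auto simp: op_scale_def fun_eq_iff algebra_simps)
qed

lemma vector_space_real_op_scale:
  assumes "vector_space sT" shows "vector_space (real_op_scale sT)"
proof -
  interpret vector_space sT by fact
  show ?thesis
    by unfold_locales (auto simp: real_op_scale_def op_scale_def fun_eq_iff algebra_simps)
qed

end

theory Submission
  imports Defs "HOL-Combinatorics.Cycles" "HOL-Library.Multiset"
begin

text \<open>Since \<open>dim V = 2\<close>, the antisymmetrizer of three letters acts by zero. On cycles, written as words,
  this says
  \<open>(ABC) + (ACB) = (A)(BC) + (B)(AC) + (C)(AB) - (A)(B)(C)\<close>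
  for non-empty words. Modulo permutations with more cycles, \<open>(ABC)\<close> is therefore skew under the exchange
  of \<open>B\<close> and \<open>C\<close>. Exchanging blocks of a cycle \<open>(abcD)\<close> three times returns it with the opposite sign,
  so all cycles of length at least 4 can be eliminated. On six letters, modulo special permutations, a
  6-cycle is skew under exchange of neighbours but invariant under rotation, an odd permutation of the
  letters, hence zero; the relation for words of lengths 1, 2, 3 then eliminates a product of two
  3-cycles. So special permutations span.

  The operators of \<open>g\<close> and its inverse are adjoint for a nondegenerate form, so inversion is well defined
  on the algebra. A symmetric element is half the sum of itself and its image, that is, a combination of
  \<open>g + inv g\<close> with \<open>g\<close> special, and for three one-letter words the relation writes
  \<open>(abc) + (acb)\<close> in terms of involutions. A basis is then selected from the spanning set.\<close>

section \<open>Reduction of cycles\<close>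

text \<open>A permutation is encoded by the list of its cycles; fixed points count as cycles of length 1.\<close>

definition cycle_lists :: "'a set \<Rightarrow> 'a list list \<Rightarrow> bool" where
  "cycle_lists S css \<longleftrightarrow> distinct (concat css) \<and> [] \<notin> set css \<and> set (concat css) \<subseteq> S"

definition special_lists :: "'a list list \<Rightarrow> bool" where
  "special_lists css \<longleftrightarrow>
     (\<forall>w\<in>set css. length w \<le> 3) \<and> length (filter (\<lambda>w. length w = 3) css) \<le> 1"

lemma cycle_lists_mset:
  assumes "mset css = mset css'"
  shows "cycle_lists S css \<longleftrightarrow> cycle_lists S css'"
proof -
  have "mset (concat css) = mset (concat css')"
    using assms by (simp add: mset_concat flip: sum_mset_sum_list)
  then show ?thesis
    unfolding cycle_lists_def using assms mset_eq_setD mset_eq_imp_distinct_iff by metis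
qed

text \<open>A cycle stands for the trace of the product of its letters, regarded as 2x2 matrices. The
  relation is the polarised Cayley-Hamilton identity for them.\<close>

locale trace_relation = vector_space s
  for s :: "'k::field_char_0 \<Rightarrow> 'w::ab_group_add \<Rightarrow> 'w" +
  fixes S :: "'a set" and Q :: "'a list list \<Rightarrow> 'w"
  assumes Q_mset: "\<lbrakk>cycle_lists S css; mset css = mset css'\<rbrakk> \<Longrightarrow> Q css = Q css'"
    and Q_rotate: "cycle_lists S ((A @ B) # Z) \<Longrightarrow> Q ((A @ B) # Z) = Q ((B @ A) # Z)"
    and Q_relation: "cycle_lists S (A # B # C # Z) \<Longrightarrow>
      Q ((A @ B @ C) # Z) + Q ((A @ C @ B) # Z) =
      Q (A # (B @ C) # Z) + Q (B # (A @ C) # Z) + Q (C # (A @ B) # Z) - Q (A # B # C # Z)"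
begin

section \<open>Rewriting cycles modulo a subspace\<close>

lemma half_mem:
  assumes U: "subspace U" and "x + x \<in> U"
  shows "x \<in> U"
proof -
  \<comment> \<open>The sign arguments below only give \<open>x + x \<in> U\<close>; characteristic
    0 permits division by 2.\<close>
  have "s (1/2) (x + x) = x"
    by (simp add: scale_right_distrib flip: scale_left_distrib)
  then show ?thesis using subspace_scale[OF assms, of "1/2"] by simp
qed

text \<open>Every term on the right of \<open>Q_relation\<close> has more cycles than those on the
  left and so lies in \<open>U\<close> by induction. Hence exchanging two blocks of a cycle costs a
  sign modulo \<open>U\<close>. The list \<open>Z\<close> holds cycles that stay untouched, so that
  part of a permutation can be reduced.\<close>

lemma long_cycles_reduce:
  assumes U: "subspace U"
    and short: "\<And>css. \<lbrakk>cycle_lists S (css @ Z); mset (concat css) = M; \<forall>w\<in>set css. length w \<le> 3\<rbrakk>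
      \<Longrightarrow> Q (css @ Z) \<in> U"
    and "cycle_lists S (css @ Z)" "mset (concat css) = M"
  shows "Q (css @ Z) \<in> U"
  using assms(3,4)
\<comment> \<open>The letters are fixed and words are non-empty, so \<open>size M\<close> bounds the
  number of cycles and the difference drops strictly when there are more of them.\<close>
proof (induction "size M - length css" arbitrary: css rule: less_induct)
  case less
  note ok = less.prems(1) and M = less.prems(2)
  have split: "Q (xs @ Z) \<in> U"
    if "length css < length xs" "cycle_lists S (xs @ Z)" "mset (concat xs) = M" for xs
  proof -
    have "length xs \<le> length (concat xs)" if "[] \<notin> set xs" for xs :: "'a list list"
      using that
    proof (induction xs)
      case (Cons w xs)
      then have "1 \<le> length w" by (cases w) auto
      then show ?case using Cons by simp
    qed simp
    moreover have "[] \<notin> set xs" using that(2) by (simp add: cycle_lists_def)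
    ultimately have "length xs \<le> size M"
      using that(3) by (metis size_mset)
    then show ?thesis using that by (intro less.hyps) auto
  qed
  show ?case
  proof (cases "\<forall>w\<in>set css. length w \<le> 3")
    case True
    then show ?thesis using short ok M by blast
  next
    case False
    then obtain w where w: "w \<in> set css" "length w > 3" by force
    \<comment> \<open>Length at least 4 makes \<open>D\<close> non-empty, so that it can serve as a
      block of its own.\<close>
    then obtain a b c D where wD: "w = a # b # c # D" "D \<noteq> []"
      by (auto simp: numeral_3_eq_3 Suc_less_eq2 length_Suc_conv less_eq_Suc_le Suc_le_length_iff)
    obtain xs ys where css: "css = xs @ w # ys" using w(1) by (meson split_list)
    define R where "R = xs @ ys"
    have eqR: "mset (css @ Z) = mset (w # R @ Z)" by (simp add: css R_def)
    have okR: "cycle_lists S (w # R @ Z)" using ok cycle_lists_mset[OF eqR] by simp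
    have QR: "Q (css @ Z) = Q (w # R @ Z)" using Q_mset[OF ok eqR] .
    have MR: "mset w + mset (concat R) = M"
      using M by (simp add: css R_def ac_simps)
    have "length css = Suc (length R)" by (simp add: css R_def)
    have swap: "Q ((A @ B @ C) # R @ Z) + Q ((A @ C @ B) # R @ Z) \<in> U"
      if "A \<noteq> []" "B \<noteq> []" "C \<noteq> []" "mset (A @ B @ C) = mset w" for A B C
    proof -
      have d: "distinct (A @ B @ C)" "set (A @ B @ C) = set w"
        using okR mset_eq_imp_distinct_iff[OF that(4)] mset_eq_setD[OF that(4)]
        by (simp_all add: cycle_lists_def)
      have okABC: "cycle_lists S (A # B # C # R @ Z)"
        using okR d that(1-3) unfolding cycle_lists_def by auto
      have mem: "Q (Y @ Z) \<in> U" if "mset (concat Y) = mset w + mset (concat R)"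
        "[] \<notin> set Y" "length css < length Y" for Y
      proof (rule split)
        have "mset (concat (Y @ Z)) = mset (concat (w # R @ Z))" using that(1) by simp
        then have "distinct (concat (Y @ Z))" "set (concat (Y @ Z)) = set (concat (w # R @ Z))"
          using okR mset_eq_setD mset_eq_imp_distinct_iff unfolding cycle_lists_def by metis+
        then show "cycle_lists S (Y @ Z)"
          using that(2) okR unfolding cycle_lists_def by auto
        show "mset (concat Y) = M" using that(1) MR by simp
      qed fact
      have "Q ((A # (B @ C) # R) @ Z) \<in> U" "Q ((B # (A @ C) # R) @ Z) \<in> U"
        "Q ((C # (A @ B) # R) @ Z) \<in> U" "Q ((A # B # C # R) @ Z) \<in> U"
        by (rule mem; use that \<open>length css = _\<close> okR in \<open>simp add: cycle_lists_def ac_simps\<close>)+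
      then show ?thesis
        unfolding Q_relation[OF okABC] by (simp add: subspace_add[OF U] subspace_diff[OF U])
    qed
    \<comment> \<open>The blocks \<open>b\<close>, \<open>c\<close>, \<open>D\<close> behind
      \<open>a\<close> are rotated by one place each time, by exchanging the first with the other
      two together. After three sign changes the original cycle is back, so the first sum minus the
      second plus the third is twice that cycle.\<close>
    have 1: "Q ((a # b # c # D) # R @ Z) + Q ((a # c # D @ [b]) # R @ Z) \<in> U"
      using swap[of "[a]" "[b]" "c # D"] by (simp add: wD)
    have 2: "Q ((a # c # D @ [b]) # R @ Z) + Q ((a # D @ [b, c]) # R @ Z) \<in> U"
      using swap[of "[a]" "[c]" "D @ [b]"] by (simp add: wD)
    have 3: "Q ((a # D @ [b, c]) # R @ Z) + Q ((a # b # c # D) # R @ Z) \<in> U"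
      using swap[of "[a]" D "[b, c]"] wD(2) by (simp add: wD)
    have "Q (w # R @ Z) + Q (w # R @ Z) \<in> U"
      using subspace_add[OF U subspace_diff[OF U 1 2] 3] by (simp add: wD algebra_simps)
    then show ?thesis unfolding QR by (rule half_mem[OF U])
  qed
qed

text \<open>Two 3-cycles need six letters, so once all cycles are short the list is special.\<close>

lemma at_most_five_letters:
  assumes U: "subspace U"
    and special: "\<And>css. \<lbrakk>cycle_lists S (css @ Z); mset (concat css) = M; special_lists css\<rbrakk>
      \<Longrightarrow> Q (css @ Z) \<in> U"
    and "cycle_lists S (css @ Z)" "mset (concat css) = M" and size: "size M \<le> 5"
  shows "Q (css @ Z) \<in> U"
proof (rule long_cycles_reduce[OF U _ assms(3,4)])
  fix css
  assume css: "cycle_lists S (css @ Z)" "mset (concat css) = M" "\<forall>w\<in>set css. length w \<le> 3"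
  have "length (filter (\<lambda>w. length w = 3) css) * 3 \<le> length (concat css)" for css :: "'a list list"
    by (induction css) auto
  from this[of css] have "length (filter (\<lambda>w. length w = 3) css) * 3 \<le> 5"
    using size css(2) by (metis size_mset le_trans)
  then show "Q (css @ Z) \<in> U" by (intro special) (use css in \<open>auto simp: special_lists_def\<close>)
qed

text \<open>The relation for \<open>[a]\<close>, \<open>[b, c]\<close>, \<open>[d, e, f]\<close>
  contains the product of the two 3-cycles as one term. Two others are 6-cycles, and each remaining
  one has a cycle of length at most 2, which leaves at most five letters to the rest.\<close>

lemma two_triples:
  assumes U: "subspace U"
    and special: "\<And>css. \<lbrakk>cycle_lists S (css @ Z); mset (concat css) = {#a,b,c,d,e,f#}; special_lists css\<rbrakk>
      \<Longrightarrow> Q (css @ Z) \<in> U"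
    and ok: "cycle_lists S ([a,b,c] # [d,e,f] # Z)"
  shows "Q ([a,b,c] # [d,e,f] # Z) \<in> U"
proof -
  let ?M = "{#a,b,c,d,e,f#}"
  have okI: "cycle_lists S (Y @ Z)" if "mset (concat Y) = ?M" "[] \<notin> set Y" for Y
  proof -
    have "mset (concat (Y @ Z)) = mset (concat ([a,b,c] # [d,e,f] # Z))" using that(1) by simp
    then have "distinct (concat (Y @ Z))" 
      "set (concat (Y @ Z)) = set (concat ([a,b,c] # [d,e,f] # Z))"
      using ok mset_eq_setD mset_eq_imp_distinct_iff unfolding cycle_lists_def by metis+
    then show "cycle_lists S (Y @ Z)"
      using that(2) ok unfolding cycle_lists_def by auto
  qed
  \<comment> \<open>The short cycle \<open>w\<close> joins the untouched cycles while
    \<open>Y\<close> is reduced. Putting it back keeps the list special, as \<open>w\<close> is not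
    a 3-cycle.\<close>
  have mem: "Q (w # Y @ Z) \<in> U"
    if "mset (concat (w # Y)) = ?M" "w \<noteq> []" "length w \<le> 2" "[] \<notin> set Y" for w Y
  proof -
    have eq: "Q (w # Y' @ Z) = Q (Y' @ w # Z)" if "cycle_lists S (Y' @ w # Z)" for Y'
      by (rule sym, rule Q_mset[OF that]) simp
    have ok': "cycle_lists S (Y @ w # Z)"
      using okI[of "w # Y"] that cycle_lists_mset[of "w # Y @ Z" "Y @ w # Z"] by simp
    have "Q (Y @ w # Z) \<in> U"
    proof (rule at_most_five_letters[OF U _ ok' refl])
      fix css assume css: "cycle_lists S (css @ w # Z)" "mset (concat css) = mset (concat Y)"
        "special_lists css"
      have "Q ((w # css) @ Z) \<in> U"
        by (rule special)
          (use that css cycle_lists_mset[of "w # css @ Z" "css @ w # Z"]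
            in \<open>auto simp: special_lists_def\<close>)
      then show "Q (css @ w # Z) \<in> U" using eq[OF css(1)] by simp
    next
      have "size (mset (concat (w # Y))) = 6" by (simp only: that(1)) simp
      then have "length w + length (concat Y) = 6" by simp
      moreover have "length w > 0" using that(2) by simp
      ultimately show "size (mset (concat Y)) \<le> 5" by (simp only: size_mset)
    qed
    then show ?thesis using eq[OF ok'] by simp
  qed
  define q where "q w = Q (w # Z)" for w
  have rot: "q [x,y,z,u,v,w] = q [y,z,u,v,w,x]" if "mset [x,y,z,u,v,w] = ?M" for x y z u v w
    using Q_rotate[of "[x]" "[y,z,u,v,w]" Z] okI[of "[[x,y,z,u,v,w]]"] that by (simp add: q_def)
  have swap: "q [x,y,z,u,v,w] + q [y,x,z,u,v,w] \<in> U"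
    if M: "mset [x,y,z,u,v,w] = ?M" for x y z u v w
  proof -
    \<comment> \<open>On the left of this relation stand a 6-cycle and, up to rotation, the same one
      with \<open>x\<close> and \<open>y\<close> exchanged; every term on the right has a cycle of
      length 1 or 2.\<close>
    have "cycle_lists S ([x] # [y] # [z,u,v,w] # Z)"
      using okI[of "[[x],[y],[z,u,v,w]]"] M by simp
    note Q_relation[OF this]
    moreover have "Q ([x] # [[y,z,u,v,w]] @ Z) \<in> U" "Q ([y] # [[x,z,u,v,w]] @ Z) \<in> U"
      "Q ([x,y] # [[z,u,v,w]] @ Z) \<in> U" "Q ([x] # [[y],[z,u,v,w]] @ Z) \<in> U"
      by (rule mem; (unfold M[symmetric])?; simp add: add_mset_commute)+
    moreover have "Q ([x,y] # [[z,u,v,w]] @ Z) = Q ([z,u,v,w] # [x,y] # Z)"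
      by (rule Q_mset) (use M okI[of "[[x,y],[z,u,v,w]]"] in simp_all)
    ultimately have "q [x,y,z,u,v,w] + q [x,z,u,v,w,y] \<in> U"
      by (simp add: q_def subspace_add[OF U] subspace_diff[OF U])
    moreover have "q [y,x,z,u,v,w] = q [x,z,u,v,w,y]"
      by (rule rot, unfold M[symmetric]) (simp add: add_mset_commute)
    ultimately show ?thesis by simp
  qed
  text \<open>Modulo \<open>U\<close> a 6-cycle changes sign when two adjacent letters are exchanged, and rotating it
    by one place amounts to five such exchanges.\<close>
  have step: "q [x,y,z,u,v,w] + q [x,z,u,v,w,y] \<in> U"
    if M: "mset [x,y,z,u,v,w] = ?M" for x y z u v w
  proof -
    have "q [y,x,z,u,v,w] = q [x,z,u,v,w,y]"
      by (rule rot, unfold M[symmetric]) (simp add: add_mset_commute)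
    then show ?thesis using swap[OF M] by simp
  qed
  have six: "q [x,y,z,u,v,w] \<in> U" if M: "mset [x,y,z,u,v,w] = ?M" for x y z u v w
  proof -
    have 1: "q [x,y,z,u,v,w] + q [x,z,u,v,w,y] \<in> U" and 2: "q [x,z,u,v,w,y] + q [x,u,v,w,y,z] \<in> U"
      and 3: "q [x,u,v,w,y,z] + q [x,v,w,y,z,u] \<in> U" and 4: "q [x,v,w,y,z,u] + q [x,w,y,z,u,v] \<in> U"
      and 5: "q [x,w,y,z,u,v] + q [x,y,z,u,v,w] \<in> U"
      by (rule step; (unfold M[symmetric])?; simp add: add_mset_commute)+
    \<comment> \<open>Here \<open>x\<close> stays in place while the other five letters are rotated,
      with one sign change per place. Since five is odd, the alternating sum collapses to twice the
      6-cycle.\<close>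
    have "(q [x,y,z,u,v,w] + q [x,z,u,v,w,y]) - (q [x,z,u,v,w,y] + q [x,u,v,w,y,z])
        + (q [x,u,v,w,y,z] + q [x,v,w,y,z,u]) - (q [x,v,w,y,z,u] + q [x,w,y,z,u,v])
        + (q [x,w,y,z,u,v] + q [x,y,z,u,v,w]) \<in> U"
      by (intro subspace_add[OF U subspace_diff[OF U subspace_add[OF U subspace_diff[OF U 1 2] 3] 4] 5])
    then have "q [x,y,z,u,v,w] + q [x,y,z,u,v,w] \<in> U" by (simp add: algebra_simps)
    then show ?thesis by (rule half_mem[OF U])
  qed
  have "cycle_lists S ([a] # [b,c] # [d,e,f] # Z)" using okI[of "[[a],[b,c],[d,e,f]]"] by simp
  note Q_relation[OF this]
  moreover have "Q ([a] # [[b,c,d,e,f]] @ Z) \<in> U" "Q ([b,c] # [[a,d,e,f]] @ Z) \<in> U"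
    "Q ([a] # [[b,c],[d,e,f]] @ Z) \<in> U"
    by (rule mem; simp add: ac_simps)+
  moreover have "Q ([a,b,c,d,e,f] # Z) \<in> U" "Q ([a,d,e,f,b,c] # Z) \<in> U"
    using six[of a b c d e f] six[of a d e f b c] by (simp_all add: q_def add_mset_commute)
  moreover have "Q ([d,e,f] # [a,b,c] # Z) = Q ([a,b,c] # [d,e,f] # Z)"
    by (rule Q_mset[OF ok, symmetric]) simp
  ultimately have "Q ([a,b,c] # [d,e,f] # Z) =
      Q ([a,b,c,d,e,f] # Z) + Q ([a,d,e,f,b,c] # Z) - Q ([a] # [[b,c,d,e,f]] @ Z)
      - Q ([b,c] # [[a,d,e,f]] @ Z) + Q ([a] # [[b,c],[d,e,f]] @ Z)"
    by (simp add: algebra_simps)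
  then show ?thesis
    using \<open>Q ([a] # [[b,c,d,e,f]] @ Z) \<in> U\<close> \<open>Q ([b,c] # [[a,d,e,f]] @ Z) \<in> U\<close>
      \<open>Q ([a] # [[b,c],[d,e,f]] @ Z) \<in> U\<close> \<open>Q ([a,b,c,d,e,f] # Z) \<in> U\<close> \<open>Q ([a,d,e,f,b,c] # Z) \<in> U\<close>
    by (auto intro!: subspace_add[OF U] subspace_diff[OF U])
qed

text \<open>Once long cycles are gone, the induction is on the number of 3-cycles: two of them are
  replaced by special lists on the same six letters, which have at most one.\<close>

lemma special_lists_span:
  assumes U: "subspace U"
    and special: "\<And>css. \<lbrakk>cycle_lists S css; mset (concat css) = M; special_lists css\<rbrakk> \<Longrightarrow> Q css \<in> U"
    and "cycle_lists S css" "mset (concat css) = M"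
  shows "Q css \<in> U"
proof -
  have "Q css \<in> U"
    if "cycle_lists S css" "mset (concat css) = M" "\<forall>w\<in>set css. length w \<le> 3" for css
    using that
  proof (induction "length (filter (\<lambda>w. length w = 3) css)" arbitrary: css rule: less_induct)
    case less
    let ?L = "\<lambda>css. filter (\<lambda>w. length w = 3) css"
    show ?case
    proof (cases "length (?L css) \<le> 1")
      case True
      then show ?thesis using special less.prems by (simp add: special_lists_def)
    next
      case False
      then obtain w1 w2 ws where ws: "?L css = w1 # w2 # ws"
        by (cases "?L css"; cases "tl (?L css)") auto
      then have "length w1 = 3" "length w2 = 3"
        using Cons_eq_filterD[OF ws[symmetric]] filter_set
        by (metis (mono_tags, lifting) list.set_intros mem_Collect_eq set_filter)+
      then obtain a b c d e f where w: "w1 = [a,b,c]" "w2 = [d,e,f]"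
        by (auto simp: numeral_3_eq_3 length_Suc_conv)
      define Z where "Z = ws @ filter (\<lambda>w. length w \<noteq> 3) css"
      have "mset css = mset (?L css) + mset (filter (\<lambda>w. length w \<noteq> 3) css)"
        by simp
      then have eq: "mset css = mset (w1 # w2 # Z)" by (simp only: ws Z_def) simp
      have ok: "cycle_lists S ([a,b,c] # [d,e,f] # Z)"
        using less.prems(1) cycle_lists_mset[OF eq] by (simp add: w)
      have "mset (concat css) = mset (concat (w1 # w2 # Z))"
        using eq by (simp add: mset_concat flip: sum_mset_sum_list)
      then have M: "mset w1 + mset w2 + mset (concat Z) = M"
        using less.prems(2) by (simp add: ac_simps)
      have Z3: "\<forall>w\<in>set Z. length w \<le> 3"
        using less.prems(3) mset_eq_setD[OF eq] by simp
      have lZ: "length (?L css) = length (?L Z) + 2"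
        using arg_cong[OF eq, of "\<lambda>m. size (filter_mset (\<lambda>w. length w = 3) m)"] w
        by (simp flip: mset_filter)
      have "Q ([a,b,c] # [d,e,f] # Z) \<in> U"
      proof (rule two_triples[OF U _ ok])
        fix Y assume Y: "cycle_lists S (Y @ Z)" "mset (concat Y) = {#a,b,c,d,e,f#}"
          "special_lists Y"
        show "Q (Y @ Z) \<in> U"
          using Y Z3 M w lZ by (intro less.hyps) (auto simp: special_lists_def)
      qed
      then show ?thesis using Q_mset[OF less.prems(1) eq] by (simp add: w)
    qed
  qed
  then show ?thesis
    using long_cycles_reduce[OF U, of "[]" M css] assms(3,4) by simp
qed

end

section \<open>Permutations from cycles\<close>

text \<open>A cycle sends each letter to the next, so gluing inserts the transposition of
  \<open>last A\<close> and the first letter of \<open>B\<close> between the two cycles. Pushed to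
  the right past the cycle of \<open>B\<close>, it becomes the transposition of the last letters. In
  this form, gluing words means multiplying on the right by a permutation of their last
  letters.\<close>

lemma cycle_of_list_append:
  assumes "distinct (A @ B)" "A \<noteq> []" "B \<noteq> []"
  shows "cycle_of_list (A @ B) =
    cycle_of_list A \<circ> cycle_of_list B \<circ> transpose (last A) (last B)"
proof -
  have *: "cycle_of_list (A @ b # bs) = cycle_of_list A \<circ> transpose (last A) b \<circ> cycle_of_list (b # bs)"
    if "A \<noteq> []" for A :: "'a list" and b bs
    using that
    by (induction A rule: cycle_of_list.induct) (simp_all add: comp_assoc)
  obtain b bs where B: "B = b # bs" using assms(3) by (cases B) auto
  have conj: "cycle_of_list B (last B) = b"
  proof -
    have "map (cycle_of_list B) B = rotate1 B"
      using cyclic_rotation[of B 1] assms(1) by simp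
    then have "last (map (cycle_of_list B) B) = last (rotate1 B)" by (rule arg_cong)
    then show ?thesis by (simp only: last_map[OF assms(3)]) (simp add: B)
  qed
  have fixA: "cycle_of_list B (last A) = last A"
    using assms(1) last_in_set[OF assms(2)] by (intro id_outside_supp) (auto simp del: last_in_set)
  have "inj (cycle_of_list B)" using permutation_of_cycle permutation_bijective bij_is_inj by blast
  then have eqs: "cycle_of_list B x = last A \<longleftrightarrow> x = last A" "cycle_of_list B x = b \<longleftrightarrow> x = last B" for x
    using conj fixA by (metis injD)+
  have "transpose (last A) b \<circ> cycle_of_list B = cycle_of_list B \<circ> transpose (last A) (last B)"
    by (simp add: fun_eq_iff transpose_def eqs conj fixA)
  then show ?thesis using *[OF assms(2), of b bs] by (simp add: B comp_assoc)
qed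

lemma orbit_cycle_of_list:
  assumes "distinct w" "x \<in> set w"
  shows "orbit (cycle_of_list w) x = set w"
proof -
  obtain i where i: "i < length w" "x = w ! i" using assms(2) by (metis in_set_conv_nth)
  have pow: "(cycle_of_list w ^^ k) x = w ! ((k + i) mod length w)" for k
    using arg_cong[OF cyclic_rotation[OF assms(1), of k], of "\<lambda>v. v ! i"] i
    by (simp add: nth_rotate)
  have "\<exists>k. w ! j = (cycle_of_list w ^^ k) x" if "j < length w" for j
    using that i unfolding pow by (intro exI[of _ "j + length w - i"]) simp
  then have "set w \<subseteq> {(cycle_of_list w ^^ k) x |k. True}"
    by (auto simp: in_set_conv_nth)
  moreover have "{(cycle_of_list w ^^ k) x |k. True} \<subseteq> set w"
    using i(1) unfolding pow by (auto intro!: nth_mem mod_less_divisor)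
  ultimately show ?thesis
    using orbit_altdef_permutation[OF permutation_of_cycle, of w x] by blast
qed

definition perm_of :: "'a list list \<Rightarrow> 'a \<Rightarrow> 'a" where
  "perm_of css = foldr (\<lambda>w p. cycle_of_list w \<circ> p) css id"

lemma perm_of_simps [simp]:
  "perm_of [] = id"
  "perm_of (w # css) = cycle_of_list w \<circ> perm_of css"
  by (simp_all add: perm_of_def)

lemma perm_of_append: "perm_of (xs @ ys) = perm_of xs \<circ> perm_of ys"
  by (induction xs) (simp_all add: comp_assoc)

lemma perm_of_permutes: "perm_of css permutes set (concat css)"
proof (induction css)
  case (Cons w css)
  have "cycle_of_list w \<circ> perm_of css permutes set (concat (w # css))"
    by (intro permutes_compose permutes_subset[OF Cons] permutes_subset[OF cycle_permutes]) auto
  then show ?case by (simp only: perm_of_simps)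
qed (simp add: fun_eq_iff)

lemma perm_of_apply:
  assumes "distinct (concat css)" "w \<in> set css" "x \<in> set w"
  shows "perm_of css x = cycle_of_list w x"
  using assms
proof (induction css)
  case (Cons v css)
  show ?case
  proof (cases "w = v")
    case True
    then have "perm_of css x = x"
      using Cons.prems perm_of_permutes[of css] by (intro permutes_not_in) auto
    then show ?thesis using True by simp
  next
    case False
    then have w: "w \<in> set css" using Cons.prems by simp
    then have "cycle_of_list w x \<in> set w"
      using permutes_in_image[OF cycle_permutes, of w x] Cons.prems by simp
    then have "cycle_of_list w x \<notin> set v" using Cons.prems w by auto
    then have "cycle_of_list v (cycle_of_list w x) = cycle_of_list w x"
      by (rule id_outside_supp)
    then show ?thesis using Cons w by simp
  qed
qed simp

lemma perm_of_mset:
  assumes "distinct (concat css)" "mset css = mset css'"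
  shows "perm_of css = perm_of css'"
proof
  fix x
  have "mset (concat css) = mset (concat css')"
    using assms(2) by (simp add: mset_concat flip: sum_mset_sum_list)
  then have d: "distinct (concat css')" and s: "set (concat css) = set (concat css')"
    using assms(1) mset_eq_imp_distinct_iff mset_eq_setD by metis+
  show "perm_of css x = perm_of css' x"
  proof (cases "x \<in> set (concat css)")
    case True
    then obtain w where "w \<in> set css" "x \<in> set w" by auto
    then show ?thesis
      using perm_of_apply assms(1) d mset_eq_setD[OF assms(2)] by metis
  next
    case False
    then have "perm_of css x = x" "perm_of css' x = x"
      using s permutes_not_in[OF perm_of_permutes] by metis+
    then show ?thesis by simp
  qed
qed

lemma orbit_perm_of:
  assumes "distinct (concat css)" "w \<in> set css" "x \<in> set w"
  shows "orbit (perm_of css) x = set w"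
proof -
  have "distinct w" using assms(1,2) by (simp add: distinct_concat_iff)
  then have orb: "orbit (cycle_of_list w) x = set w" using assms(3) by (rule orbit_cycle_of_list)
  have "orbit (perm_of css) x = orbit (cycle_of_list w) x"
    by (rule orbit_cong) (use orb assms perm_of_apply in auto)
  then show ?thesis using orb by simp
qed

lemma cycle_lists_exist:
  assumes "g permutes S" "finite S"
  obtains css where "cycle_lists S css" "set (concat css) = S" "perm_of css = g"
proof -
  have "\<exists>css. cycle_lists S css \<and> set (concat css) = S \<and> perm_of css = g"
    using cycle_decomposition[OF assms]
  proof induction
    case empty
    show ?case by (intro exI[of _ "[]"]) (simp add: cycle_lists_def)
  next
    case (comp I p w)
    then obtain css where css: "cycle_lists I css" "set (concat css) = I" "perm_of css = p"
      by blast
    show ?case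
    \<comment> \<open>The decomposition may contribute an empty word, which
      \<open>cycle_lists\<close> excludes.\<close>
    proof (cases "w = []")
      case True
      then show ?thesis using css by auto
    next
      case False
      show ?thesis
        by (intro exI[of _ "w # css"]) (use css comp False in \<open>auto simp: cycle_lists_def\<close>)
    qed
  qed
  then show ?thesis using that by blast
qed

text \<open>\<open>P\<close> annihilates the products of \<open>g\<close> with the antisymmetrizer of three letters.\<close>

definition alternating_relation :: "nat \<Rightarrow> ((nat \<Rightarrow> nat) \<Rightarrow> 'w::ab_group_add) \<Rightarrow> bool" where
  "alternating_relation n P \<longleftrightarrow>
     (\<forall>g a b c. g permutes {1..n} \<and> {a, b, c} \<subseteq> {1..n} \<and> distinct [a, b, c] \<longrightarrow>
        P (g \<circ> transpose b c \<circ> transpose a c) + P (g \<circ> transpose b c \<circ> transpose a b) =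
        P (g \<circ> transpose b c) + P (g \<circ> transpose a c) + P (g \<circ> transpose a b) - P g)"

text \<open>With \<open>g\<close> the product of all the cycles taken separately, the six
  permutations in the trace relation are \<open>g\<close> times the six permutations of the last
  letters of \<open>A\<close>, \<open>B\<close>, \<open>C\<close>.\<close>

lemma trace_relation_perm_of:
  fixes s :: "'k::field_char_0 \<Rightarrow> 'w::ab_group_add \<Rightarrow> 'w"
  assumes "vector_space s" and rel: "alternating_relation n P"
  shows "trace_relation s {1..n} (\<lambda>css. P (perm_of css))"
proof -
  interpret vector_space s by fact
  show ?thesis
  proof
    fix css css' :: "nat list list"
    assume "cycle_lists {1..n} css" "mset css = mset css'"
    then show "P (perm_of css) = P (perm_of css')"
      using perm_of_mset[of css css'] by (simp add: cycle_lists_def)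
  next
    fix A B :: "nat list" and Z
    assume "cycle_lists {1..n} ((A @ B) # Z)"
    then have d: "distinct (A @ B)" by (auto simp: cycle_lists_def)
    have "cycle_of_list (B @ A) = cycle_of_list (A @ B)"
      using cycle_of_list_rotate_independent[OF d, of "length A"] by (simp add: rotate_append)
    then show "P (perm_of ((A @ B) # Z)) = P (perm_of ((B @ A) # Z))" by simp
  next
    fix A B C :: "nat list" and Z
    assume ok: "cycle_lists {1..n} (A # B # C # Z)"
    define g where "g = perm_of (Z @ [A, B, C])"
    let ?a = "last A" and ?b = "last B" and ?c = "last C"
    have ne: "A \<noteq> []" "B \<noteq> []" "C \<noteq> []" and d: "distinct (concat (A # B # C # Z))"
      and sub: "set (concat (A # B # C # Z)) \<subseteq> {1..n}"
      using ok by (auto simp: cycle_lists_def)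
    have disj: "set A \<inter> set B = {}" "set A \<inter> set C = {}" "set B \<inter> set C = {}"
      "set B \<inter> set A = {}" "set C \<inter> set A = {}" "set C \<inter> set B = {}"
      using d by auto
    \<comment> \<open>Disjoint cycles commute, so \<open>Z\<close> can be moved to the left and
      \<open>t\<close> stands at the right end; \<open>vs\<close> may list \<open>A\<close>,
      \<open>B\<close>, \<open>C\<close> in any order.\<close>
    have front: "perm_of (ws @ Z) = g \<circ> t"
      if "distinct (concat (ws @ Z))" "perm_of ws = perm_of vs \<circ> t" "mset vs = mset [A, B, C]"
      for ws vs t
    proof -
      have "perm_of (ws @ Z) = perm_of (Z @ ws)"
        using that(1) by (rule perm_of_mset) simp
      also have "\<dots> = perm_of (Z @ vs) \<circ> t"
        by (simp only: perm_of_append that(2) comp_assoc)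
      also have "perm_of (Z @ vs) = g"
        unfolding g_def by (rule sym, rule perm_of_mset) (use d that(3) in auto)
      finally show ?thesis .
    qed
    have g1: "perm_of ((A @ B @ C) # Z) = g \<circ> transpose ?b ?c \<circ> transpose ?a ?c"
      using front[of "[A @ B @ C]" "[A, B, C]" "transpose ?b ?c \<circ> transpose ?a ?c"] d ne disj
      by (simp add: cycle_of_list_append comp_assoc transpose_commute Int_Un_distrib Int_Un_distrib2)
    have g2: "perm_of ((A @ C @ B) # Z) = g \<circ> transpose ?b ?c \<circ> transpose ?a ?b"
      using front[of "[A @ C @ B]" "[A, C, B]" "transpose ?b ?c \<circ> transpose ?a ?b"] d ne disj
      by (simp add: cycle_of_list_append comp_assoc transpose_commute Int_Un_distrib Int_Un_distrib2)
    have g3: "perm_of (A # (B @ C) # Z) = g \<circ> transpose ?b ?c"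
      using front[of "[A, B @ C]" "[A, B, C]" "transpose ?b ?c"] d ne disj
      by (simp add: cycle_of_list_append comp_assoc transpose_commute Int_Un_distrib Int_Un_distrib2)
    have g4: "perm_of (B # (A @ C) # Z) = g \<circ> transpose ?a ?c"
      using front[of "[B, A @ C]" "[B, A, C]" "transpose ?a ?c"] d ne disj
      by (simp add: cycle_of_list_append comp_assoc transpose_commute Int_Un_distrib Int_Un_distrib2)
    have g5: "perm_of (C # (A @ B) # Z) = g \<circ> transpose ?a ?b"
      using front[of "[C, A @ B]" "[C, A, B]" "transpose ?a ?b"] d ne disj
      by (simp add: cycle_of_list_append comp_assoc transpose_commute Int_Un_distrib Int_Un_distrib2)
    have g6: "perm_of (A # B # C # Z) = g"
      using front[of "[A, B, C]" "[A, B, C]" "id"] d ne disj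
      by (simp add: cycle_of_list_append comp_assoc transpose_commute Int_Un_distrib Int_Un_distrib2)
    have "g permutes {1..n}"
      unfolding g_def by (rule permutes_subset[OF perm_of_permutes]) (use sub in auto)
    moreover have "{?a, ?b, ?c} \<subseteq> {1..n}" "distinct [?a, ?b, ?c]"
      using ne d sub last_in_set[of A] last_in_set[of B] last_in_set[of C]
      by (auto simp del: last_in_set)
    ultimately show "P (perm_of ((A @ B @ C) # Z)) + P (perm_of ((A @ C @ B) # Z)) =
      P (perm_of (A # (B @ C) # Z)) + P (perm_of (B # (A @ C) # Z)) + P (perm_of (C # (A @ B) # Z))
      - P (perm_of (A # B # C # Z))"
      using rel unfolding g1 g2 g3 g4 g5 g6 alternating_relation_def by blast
  qed
qed

section \<open>Special permutations and involutions\<close>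

definition special_perms :: "nat \<Rightarrow> (nat \<Rightarrow> nat) set" where
  "special_perms n =
     perm_of ` {css. cycle_lists {1..n} css \<and> set (concat css) = {1..n} \<and> special_lists css}"

text \<open>The reduction keeps the multiset of letters, so the special lists it reaches still cover
  \<open>{1..n}\<close>, with fixed points as words of length 1.\<close>

lemma special_perms_span:
  fixes s :: "'k::field_char_0 \<Rightarrow> 'w::ab_group_add \<Rightarrow> 'w"
  assumes "vector_space s" and rel: "alternating_relation n P" and g: "g \<in> sym_group n"
  shows "P g \<in> module.span s (P ` special_perms n)"
proof -
  interpret trace_relation s "{1..n}" "\<lambda>css. P (perm_of css)"
    using assms(1,2) by (rule trace_relation_perm_of)
  obtain css where css: "cycle_lists {1..n} css" "set (concat css) = {1..n}" "perm_of css = g"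
    using g cycle_lists_exist[of g "{1..n}"] by (auto simp: sym_group_def)
  have "P (perm_of css) \<in> span (P ` special_perms n)"
  proof (rule special_lists_span[OF subspace_span _ css(1) refl])
    fix css' assume css': "cycle_lists {1..n} css'" "mset (concat css') = mset (concat css)"
      "special_lists css'"
    then have "set (concat css') = {1..n}" using css(2) mset_eq_setD by metis
    then show "P (perm_of css') \<in> span (P ` special_perms n)"
      using css' by (auto simp: special_perms_def intro!: span_base)
  qed
  then show ?thesis by (simp add: css(3))
qed

text \<open>The bridge from words to the orbits used in \<open>is_involution\<close> and
  \<open>is_special\<close>.\<close>

lemma perm_cycles_perm_of:
  assumes "cycle_lists {1..n} css" "set (concat css) = {1..n}"
  shows "perm_cycles n (perm_of css) = set ` set css"
proof -
  have d: "distinct (concat css)" and ne: "[] \<notin> set css"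
    using assms(1) by (auto simp: cycle_lists_def)
  have "set w \<in> orbit (perm_of css) ` {1..n}" if "w \<in> set css" for w
  proof -
    have "hd w \<in> set w" using ne that by (intro hd_in_set) auto
    then have "orbit (perm_of css) (hd w) = set w" "hd w \<in> {1..n}"
      using orbit_perm_of[OF d that] that assms(2) by auto
    then show ?thesis by blast
  qed
  moreover have "orbit (perm_of css) x \<in> set ` set css" if "x \<in> {1..n}" for x
  proof -
    have "x \<in> set (concat css)" using that by (simp only: assms(2))
    then obtain w where "w \<in> set css" "x \<in> set w" by auto
    then show ?thesis using orbit_perm_of[OF d] by blast
  qed
  ultimately show ?thesis unfolding perm_cycles_def by blast
qed

lemma perm_of_in_sym_group:
  "cycle_lists {1..n} css \<Longrightarrow> perm_of css \<in> sym_group n"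
  unfolding sym_group_def cycle_lists_def
  using permutes_subset[OF perm_of_permutes] by blast

lemma card_cycle:
  assumes "cycle_lists S css" "w \<in> set css"
  shows "card (set w) = length w" "length w > 0"
  using assms by (auto simp: cycle_lists_def distinct_concat_iff distinct_card)

lemma special_perms_subset: "special_perms n \<subseteq> sym_group n"
  using perm_of_in_sym_group by (auto simp: special_perms_def)

lemma is_involution_perm_of:
  assumes css: "cycle_lists {1..n} css" "set (concat css) = {1..n}"
    and len: "\<forall>w\<in>set css. length w \<le> 2"
  shows "is_involution n (perm_of css)"
proof -
  have "card (set w) = 1 \<or> card (set w) = 2" if "w \<in> set css" for w
    using card_cycle[OF css(1) that] bspec[OF len that] by arith
  then show ?thesis
    unfolding is_involution_def perm_cycles_perm_of[OF css] using perm_of_in_sym_group[OF css(1)]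
    by simp
qed

lemma special_lists_cases:
  assumes "special_lists css"
  obtains "\<forall>w\<in>set css. length w \<le> 2"
    | a b c Z where "mset css = mset ([a, b, c] # Z)" "\<forall>w\<in>set Z. length w \<le> 2"
proof (cases "\<forall>w\<in>set css. length w \<le> 2")
  case False
  then obtain w where w: "w \<in> set css" "length w > 2" by force
  then have 3: "length w = 3" using assms by (auto simp: special_lists_def)
  then obtain a b c where abc: "w = [a, b, c]" by (auto simp: numeral_3_eq_3 length_Suc_conv)
  obtain xs ys where css: "css = xs @ w # ys" using w(1) by (meson split_list)
  have "filter (\<lambda>w. length w = 3) (xs @ ys) = []"
    using assms 3 by (auto simp: special_lists_def css)
  then have "length v \<noteq> 3" if "v \<in> set (xs @ ys)" for v
    using that by (metis (mono_tags, lifting) filter_empty_conv)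
  moreover have "length v \<le> 3" if "v \<in> set (xs @ ys)" for v
    using that assms by (auto simp: special_lists_def css)
  ultimately have "\<forall>v\<in>set (xs @ ys). length v \<le> 2" by fastforce
  then show ?thesis using that(2)[of a b c "xs @ ys"] by (simp add: css abc)
qed (use that in blast)

lemma is_special_special_perms:
  assumes "g \<in> special_perms n"
  shows "is_special n g"
proof -
  obtain css where css: "cycle_lists {1..n} css" "set (concat css) = {1..n}"
    and sp: "special_lists css" and g: "g = perm_of css"
    using assms by (auto simp: special_perms_def)
  show ?thesis
    using sp
  proof (cases rule: special_lists_cases)
    case 1
    then show ?thesis using is_involution_perm_of[OF css] by (simp add: g is_special_def)
  next
    case (2 a b c Z)
    then have set_css: "set css = insert [a, b, c] (set Z)"
      using mset_eq_setD[OF 2(1)] by simp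
    have len: "card (set w) = 1 \<or> card (set w) = 2" if "w \<in> set Z" for w
      using card_cycle[OF css(1), of w] bspec[OF 2(2) that] that set_css by (simp del: length_greater_0_conv) arith
    have "card {a, b, c} = 3"
      using card_cycle[OF css(1), of "[a, b, c]"] set_css by simp
    moreover have cyc: "perm_cycles n g = insert {a, b, c} (set ` set Z)"
      unfolding g perm_cycles_perm_of[OF css] set_css by simp
    moreover have "card C \<noteq> 3" if "C \<in> set ` set Z" for C
      using that len by force
    ultimately have "\<exists>!C. C \<in> perm_cycles n g \<and> card C = 3"
      by (intro ex1I[of _ "{a, b, c}"]) auto
    moreover have "\<forall>C\<in>perm_cycles n g. card C = 3 \<or> card C = 1 \<or> card C = 2"
      unfolding cyc using len \<open>card {a, b, c} = 3\<close> by blast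
    ultimately show ?thesis
      using perm_of_in_sym_group[OF css(1)] by (simp add: is_special_def g)
  qed
qed

lemma perm_of_involutive:
  assumes "distinct (concat Z)" "\<forall>w\<in>set Z. length w \<le> 2"
  shows "perm_of Z (perm_of Z x) = x"
proof (cases "x \<in> set (concat Z)")
  case True
  then obtain w where w: "w \<in> set Z" "x \<in> set w" by auto
  have "cycle_of_list w x \<in> set w"
    using permutes_in_image[OF cycle_permutes, of w x] w by simp
  then have "perm_of Z (perm_of Z x) = cycle_of_list w (cycle_of_list w x)"
    using perm_of_apply[OF assms(1) w(1)] w(2) by simp
  moreover have "w = [x] \<or> (\<exists>y. w = [x, y]) \<or> (\<exists>y. w = [y, x])"
  proof (cases w rule: cycle_of_list.cases)
    case (1 i j cs)
    then show ?thesis using w assms(2) by auto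
  qed (use w in auto)
  ultimately show ?thesis by auto
next
  case False
  then show ?thesis by (metis perm_of_permutes permutes_not_in)
qed

lemma is_involution_inv:
  assumes "is_involution n g"
  shows "inv g = g"
proof -
  have g: "g permutes {1..n}"
    and c: "\<And>x. x \<in> {1..n} \<Longrightarrow> card (orbit g x) = 1 \<or> card (orbit g x) = 2"
    using assms by (auto simp: is_involution_def perm_cycles_def sym_group_def)
  have "g (g x) = x" for x
  proof (rule ccontr)
    assume ne: "g (g x) \<noteq> x"
    then have x: "x \<in> {1..n}" using g by (metis permutes_not_in)
    have gx: "g x \<noteq> x" using ne by auto
    then have ggx: "g (g x) \<noteq> g x" using permutes_inj[OF g] by (metis injD)
    have "permutation g" using g permutation_permutes by blast
    \<comment> \<open>These three points are distinct, too many for an orbit of size 1 or 2.\<close>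
    then have "{x, g x, g (g x)} \<subseteq> orbit g x" "finite (orbit g x)"
      using permutation_self_in_orbit[of g x] finite_orbit[of x g] by (auto intro: orbit.intros)
    then have "card {x, g x, g (g x)} \<le> card (orbit g x)" by (intro card_mono)
    then show False using c[OF x] ne gx ggx by auto
  qed
  then show ?thesis by (intro inv_unique_comp) (simp_all add: fun_eq_iff)
qed

text \<open>Inversion reverses the 3-cycle and fixes the shorter cycles. So the relation for
  \<open>[a]\<close>, \<open>[b]\<close>, \<open>[c]\<close> has \<open>P g + P (inv g)\<close> on
  its left and only cycles of length at most 2 on its right.\<close>

lemma special_perm_add_inverse:
  fixes s :: "'k::field_char_0 \<Rightarrow> 'w::ab_group_add \<Rightarrow> 'w"
  assumes "vector_space s" and rel: "alternating_relation n P" and g: "g \<in> special_perms n"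
  shows "P g + P (inv g) \<in> module.span s (P ` {g. is_involution n g})"
proof -
  interpret trace_relation s "{1..n}" "\<lambda>css. P (perm_of css)"
    using assms(1,2) by (rule trace_relation_perm_of)
  let ?U = "span (P ` {g. is_involution n g})"
  obtain css where css: "cycle_lists {1..n} css" "set (concat css) = {1..n}"
    and sp: "special_lists css" and g: "g = perm_of css"
    using g by (auto simp: special_perms_def)
  show ?thesis
    using sp
  proof (cases rule: special_lists_cases)
    case 1
    then have "is_involution n g" using is_involution_perm_of[OF css] by (simp add: g)
    then show ?thesis by (simp add: is_involution_inv span_add span_base)
  next
    case (2 a b c Z)
    have ok: "cycle_lists {1..n} ([a, b, c] # Z)" using css(1) cycle_lists_mset[OF 2(1)] by simp
    have "mset (concat css) = mset (concat ([a, b, c] # Z))"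
      using 2(1) by (simp add: mset_concat flip: sum_mset_sum_list)
    then have cover: "set (concat ([a, b, c] # Z)) = {1..n}"
      using css(2) mset_eq_setD by metis
    have g': "g = perm_of ([a, b, c] # Z)"
      using perm_of_mset[OF _ 2(1)] css(1) by (simp add: g cycle_lists_def)
    have dZ: "distinct (concat Z)" and d: "distinct (concat ([a, c, b] # Z))"
      using ok by (auto simp: cycle_lists_def)
    have h: "perm_of ([a, c, b] # Z) = perm_of (Z @ [[a, c, b]])"
      by (rule perm_of_mset[OF d]) simp
    have "cycle_of_list [a, c, b] (cycle_of_list [a, b, c] x) = x"
      "cycle_of_list [a, b, c] (cycle_of_list [a, c, b] x) = x" for x
      using d by (auto simp: transpose_def)
    then have "g \<circ> perm_of (Z @ [[a, c, b]]) = id" "perm_of (Z @ [[a, c, b]]) \<circ> g = id"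
      unfolding g' perm_of_append
      using perm_of_involutive[OF dZ 2(2)] by (auto simp: fun_eq_iff simp del: cycle_of_list.simps)
    then have inv: "inv g = perm_of ([a, c, b] # Z)"
      unfolding h by (rule inv_unique_comp)
    have mem: "P (perm_of (Y @ Z)) \<in> ?U"
      if "mset (concat Y) = {#a, b, c#}" "[] \<notin> set Y" "\<forall>w\<in>set Y. length w \<le> 2" for Y
    proof -
      have "mset (concat (Y @ Z)) = mset (concat ([a, b, c] # Z))" using that(1) by simp
      then have "distinct (concat (Y @ Z))" "set (concat (Y @ Z)) = {1..n}"
        using ok cover mset_eq_setD mset_eq_imp_distinct_iff unfolding cycle_lists_def by metis+
      then have "is_involution n (perm_of (Y @ Z))"
        using that(2,3) 2(2) ok by (intro is_involution_perm_of) (auto simp: cycle_lists_def)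
      then show ?thesis by (intro span_base) blast
    qed
    have "cycle_lists {1..n} ([a] # [b] # [c] # Z)" using ok by (auto simp: cycle_lists_def)
    from Q_relation[OF this] have "P g + P (inv g) =
      P (perm_of ([[a], [b, c]] @ Z)) + P (perm_of ([[b], [a, c]] @ Z))
      + P (perm_of ([[c], [a, b]] @ Z)) - P (perm_of ([[a], [b], [c]] @ Z))"
      by (simp only: inv) (simp only: g' append_Cons append_Nil)
    also have "\<dots> \<in> ?U"
      by (intro span_add span_diff mem) (simp_all add: add_mset_commute)
    finally show ?thesis .
  qed
qed

section \<open>Operators on the tensor power\<close>

text \<open>Coefficients are indexed by \<open>I\<close> rather than by the image, because different
  permutations may give the same operator.\<close>

lemma (in module) span_image_finite:
  assumes "finite I" "x \<in> span (f ` I)"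
  obtains c where "x = (\<Sum>i\<in>I. c i *s f i)"
proof -
  have "\<exists>c. x = (\<Sum>i\<in>I. c i *s f i)"
    using assms(2)
  proof (induction rule: span_induct_alt)
    case base
    show ?case by (intro exI[of _ "\<lambda>_. 0"]) simp
  next
    case (step c x y)
    then obtain i d where i: "i \<in> I" "x = f i" and d: "y = (\<Sum>i\<in>I. d i *s f i)" by blast
    have "c *s x + y = (\<Sum>j\<in>I. (d j + (if j = i then c else 0)) *s f j)"
      using assms(1) i by (simp add: d scale_left_distrib sum.distrib if_distrib[of "\<lambda>a. a *s _"] sum.delta cong: if_cong)
    then show ?case by (intro exI[of _ "\<lambda>j. d j + (if j = i then c else 0)"])
  qed
  then show ?thesis using that by blast
qed

lemma sum_fun_apply: "(\<Sum>i\<in>I. f i) x = (\<Sum>i\<in>I. f i x)"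
  by (induction I rule: infinite_finite_induct) auto

text \<open>The antisymmetrization of \<open>m\<close> is an alternating trilinear map and vanishes
  in dimension 2. Expanding the arguments in \<open>e\<close> and \<open>f\<close> turns the claim
  into an identity in coordinates.\<close>

lemma trilinear_alternating_zero:
  fixes sV :: "'f::field \<Rightarrow> 'v::ab_group_add \<Rightarrow> 'v" and sT :: "'f \<Rightarrow> 't::ab_group_add \<Rightarrow> 't"
  assumes lin: "\<And>y z. Vector_Spaces.linear sV sT (\<lambda>x. m x y z)"
    "\<And>x z. Vector_Spaces.linear sV sT (\<lambda>y. m x y z)"
    "\<And>x y. Vector_Spaces.linear sV sT (\<lambda>z. m x y z)"
    and span: "module.span sV {e, f} = UNIV"
  shows "m z x y + m y z x = m x z y + m z y x + m y x z - m x y z"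
proof -
  interpret l: Vector_Spaces.linear sV sT "\<lambda>x. m x y z" by (rule lin)
  have add: "m (x + x') y z = m x y z + m x' y z" "m x (y + y') z = m x y z + m x y' z"
    "m x y (z + z') = m x y z + m x y z'" for x y z x' y' z'
    using lin by (simp_all add: Vector_Spaces.linear_iff)
  have scale: "m (sV c x) y z = sT c (m x y z)" "m x (sV c y) z = sT c (m x y z)"
    "m x y (sV c z) = sT c (m x y z)" for c x y z
    using lin by (simp_all add: Vector_Spaces.linear_iff)
  have ex: "\<exists>p q. x = sV p e + sV q f" for x
  proof -
    have "x \<in> l.vs1.span {e, f}" using span by simp
    then obtain p where "x - sV p e \<in> l.vs1.span {f}" by (auto simp: l.vs1.span_breakdown_eq)
    then obtain q where "x - sV p e = sV q f" by (auto simp: l.vs1.span_singleton)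
    then show ?thesis by (metis add.commute diff_add_cancel)
  qed
  obtain x1 x2 y1 y2 z1 z2 where "x = sV x1 e + sV x2 f" "y = sV y1 e + sV y2 f"
    "z = sV z1 e + sV z2 f" using ex by meson
  then show ?thesis
    by (simp add: add scale l.vs2.scale_right_distrib l.vs2.scale_right_diff_distrib ac_simps algebra_simps)
qed

lemma finite_sym_group: "finite (sym_group n)"
  unfolding sym_group_def by (rule finite_permutations) simp

lemma sym_group_inv: "g \<in> sym_group n \<Longrightarrow> inv g \<in> sym_group n"
  by (simp add: sym_group_def permutes_inv)

lemma sum_sym_group_inv: "(\<Sum>g\<in>sym_group n. f (inv g)) = (\<Sum>g\<in>sym_group n. f g)"
  by (rule sum.reindex_bij_witness[of _ inv inv])
    (auto simp: sym_group_inv, auto simp: sym_group_def permutes_inv_inv)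

context tensor_power
begin

section \<open>The alternating relation for permutation operators\<close>

lemma linear_eq_pure:
  assumes "Vector_Spaces.linear sT sT f" "Vector_Spaces.linear sT sT g" "\<And>v. f (\<tau> v) = g (\<tau> v)"
  shows "f = g"
proof
  interpret TT: vector_space_pair sT sT by unfold_locales
  fix x
  show "f x = g x"
    using TT.linear_eq_on[OF assms(1,2), of x "range \<tau>"] assms(3) span_pure by auto
qed

lemma alternating_relation_perm_op:
  assumes dim: "V.dim UNIV = 2"
  shows "alternating_relation n (perm_op sT \<tau>)"
  unfolding alternating_relation_def
proof (intro allI impI)
  obtain B where B: "V.span B = UNIV" "card B = 2"
    using V.basis_exists[of UNIV] dim by (metis UNIV_I subsetI subset_antisym)
  then obtain e f where ef: "V.span {e, f} = UNIV" by (metis card_2_iff)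
  fix g a b c
  assume "g permutes {1..n} \<and> {a, b, c} \<subseteq> {1..n} \<and> distinct [a, b, c]"
  then have g: "g permutes {1..n}" and abc: "{a, b, c} \<subseteq> {1..n}" "distinct [a, b, c]" by auto
  have gsym: "g \<in> sym_group n" using g by (simp add: sym_group_def)
  interpret g: Vector_Spaces.linear sT sT "perm_op sT \<tau> g" by (rule perm_op(1)[OF gsym])
  have t: "transpose i j permutes {1..n}" if "i \<in> {a, b, c}" "j \<in> {a, b, c}" for i j
    using that abc by (intro permutes_swap_id) auto
  have sym: "g \<circ> p \<in> sym_group n" if "p permutes {1..n}" for p
    using g that by (simp add: sym_group_def permutes_compose)
  \<comment> \<open>The operator of \<open>g \<circ> p\<close> permutes the factors by
    \<open>p\<close> first, so \<open>g\<close> can be pulled out and only the positions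
    \<open>a\<close>, \<open>b\<close>, \<open>c\<close> matter.\<close>
  have act: "perm_op sT \<tau> (g \<circ> p) (\<tau> v) = perm_op sT \<tau> g (\<tau> (v \<circ> inv p))"
    if "p permutes {1..n}" for p v
    using perm_op(2)[OF sym[OF that]] perm_op(2)[OF gsym] g that
    by (simp add: o_inv_distrib permutes_bij comp_assoc)
  define m where "m v x y z = \<tau> (v(a := x, b := y, c := z))" for v x y z
  have lin: "Vector_Spaces.linear sV sT (\<lambda>x. \<tau> (u(i := x)))" if "i \<in> {a, b, c}" for u i
    using multilinear abc(1) that by (auto simp: multilinear_map_def)
  have "m v z x y + m v y z x = m v x z y + m v z y x + m v y x z - m v x y z" for v x y z
  proof (rule trilinear_alternating_zero[OF _ _ _ ef])
    show "Vector_Spaces.linear sV sT (\<lambda>x. m v x y z)" for y z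
      using lin[of a "v(b := y, c := z)"] abc(2) by (simp add: m_def fun_upd_twist)
    show "Vector_Spaces.linear sV sT (\<lambda>y. m v x y z)" for x z
      using lin[of b "v(a := x, c := z)"] abc(2) by (simp add: m_def fun_upd_twist)
    show "Vector_Spaces.linear sV sT (\<lambda>z. m v x y z)" for x y
      using lin[of c "v(a := x, b := y)"] by (simp add: m_def)
  qed
  \<comment> \<open>Taking the three vectors from \<open>v\<close> itself turns the six values of
    \<open>m\<close> into pure tensors with the entries of \<open>v\<close> at \<open>a\<close>,
    \<open>b\<close>, \<open>c\<close> permuted.\<close>
  from this[of v "v a" "v b" "v c" for v]
  have alt: "\<tau> (v \<circ> transpose a c \<circ> transpose b c) + \<tau> (v \<circ> transpose a b \<circ> transpose b c) =
    \<tau> (v \<circ> transpose b c) + \<tau> (v \<circ> transpose a c) + \<tau> (v \<circ> transpose a b) - \<tau> v" for v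
  proof -
    have "v \<circ> transpose a c \<circ> transpose b c = v(a := v c, b := v a, c := v b)"
      "v \<circ> transpose a b \<circ> transpose b c = v(a := v b, b := v c, c := v a)"
      "v \<circ> transpose b c = v(a := v a, b := v c, c := v b)"
      "v \<circ> transpose a c = v(a := v c, b := v b, c := v a)"
      "v \<circ> transpose a b = v(a := v b, b := v a, c := v c)"
      "v = v(a := v a, b := v b, c := v c)"
      using abc(2) by (auto simp: fun_eq_iff transpose_def)
    then show ?thesis
      using \<open>\<And>v. m v (v c) (v a) (v b) + _ v = _ v\<close>[of v] unfolding m_def by metis
  qed
  have inv2: "inv (transpose i j \<circ> transpose k l) = transpose k l \<circ> transpose i j" for i j k l :: nat
    by (simp add: o_inv_distrib)
  have act_transpose: "perm_op sT \<tau> (g \<circ> transpose i j) (\<tau> v) =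
      perm_op sT \<tau> g (\<tau> (v \<circ> transpose i j))" if "i \<in> {a, b, c}" "j \<in> {a, b, c}" for i j v
    using act[OF t[OF that]] by simp
  let ?P = "perm_op sT \<tau>"
  let ?p1 = "transpose b c \<circ> transpose a c" and ?p2 = "transpose b c \<circ> transpose a b"
  have perms: "?p1 permutes {1..n}" "?p2 permutes {1..n}"
    by (intro permutes_compose t; simp)+
  have "?P (g \<circ> ?p1) + ?P (g \<circ> ?p2) - ?P (g \<circ> transpose b c) - ?P (g \<circ> transpose a c)
      - ?P (g \<circ> transpose a b) + ?P g = (\<lambda>_. 0)"
  proof (rule linear_eq_pure)
    have L: "Vector_Spaces.linear sT sT (?P (g \<circ> p))" if "p permutes {1..n}" for p
      using perm_op(1)[OF sym[OF that]] .
    show "Vector_Spaces.linear sT sT (?P (g \<circ> ?p1) + ?P (g \<circ> ?p2) - ?P (g \<circ> transpose b c)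
        - ?P (g \<circ> transpose a c) - ?P (g \<circ> transpose a b) + ?P g)"
      using L[OF perms(1)] L[OF perms(2)] L[OF t[of b c]] L[OF t[of a c]] L[OF t[of a b]] perm_op(1)[OF gsym]
      by (auto simp: Vector_Spaces.linear_iff algebra_simps)
    show "Vector_Spaces.linear sT sT (\<lambda>_. 0)"
      by (simp add: Vector_Spaces.linear_iff T.vector_space_axioms)
    fix v
    have "(?P (g \<circ> ?p1) + ?P (g \<circ> ?p2) - ?P (g \<circ> transpose b c) - ?P (g \<circ> transpose a c)
        - ?P (g \<circ> transpose a b) + ?P g) (\<tau> v) =
      ?P g (\<tau> (v \<circ> transpose a c \<circ> transpose b c)) + ?P g (\<tau> (v \<circ> transpose a b \<circ> transpose b c))
      - ?P g (\<tau> (v \<circ> transpose b c)) - ?P g (\<tau> (v \<circ> transpose a c)) - ?P g (\<tau> (v \<circ> transpose a b))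
      + ?P g (\<tau> v)"
      by (simp add: act[OF perms(1)] act[OF perms(2)] act_transpose inv2 comp_assoc)
    also have "\<dots> = ?P g (\<tau> (v \<circ> transpose a c \<circ> transpose b c) + \<tau> (v \<circ> transpose a b \<circ> transpose b c)
      - \<tau> (v \<circ> transpose b c) - \<tau> (v \<circ> transpose a c) - \<tau> (v \<circ> transpose a b) + \<tau> v)"
      by (simp only: g.add g.diff)
    also have "\<dots> = 0" unfolding alt by simp
    finally show "(?P (g \<circ> ?p1) + ?P (g \<circ> ?p2) - ?P (g \<circ> transpose b c) - ?P (g \<circ> transpose a c)
        - ?P (g \<circ> transpose a b) + ?P g) (\<tau> v) = 0" .
  qed
  then show "?P (g \<circ> transpose b c \<circ> transpose a c) + ?P (g \<circ> transpose b c \<circ> transpose a b) =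
    ?P (g \<circ> transpose b c) + ?P (g \<circ> transpose a c) + ?P (g \<circ> transpose a b) - ?P g"
    by (simp add: comp_assoc fun_eq_iff algebra_simps)
qed

section \<open>Basis tensors and the adjoint form\<close>

lemma span_pure_basis:
  assumes B: "V.span B = UNIV"
  shows "T.span (\<tau> ` ({1..n} \<rightarrow>\<^sub>E B)) = UNIV"
proof -
  let ?S = "T.span (\<tau> ` ({1..n} \<rightarrow>\<^sub>E B))"
  \<comment> \<open>The first \<open>k\<close> entries are arbitrary and the others are basis
    vectors; linearity in entry \<open>Suc k\<close> gives the step. At \<open>k = n\<close> every
    pure tensor is covered.\<close>
  have "\<tau> v \<in> ?S" if "k \<le> n" "\<And>i. i \<in> {k<..n} \<Longrightarrow> v i \<in> B" for k v
    using that
  proof (induction k arbitrary: v)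
    case 0
    \<comment> \<open>Values outside \<open>{1..n}\<close> do not affect \<open>\<tau>\<close>;
      extensional tuples form a finite set when \<open>B\<close> is finite.\<close>
    have "\<tau> v = \<tau> (restrict v {1..n})"
      using multilinear by (auto simp: multilinear_map_def)
    also have "\<dots> \<in> ?S"
      using 0 by (intro T.span_base imageI) auto
    finally show ?case .
  next
    case (Suc k)
    interpret l: Vector_Spaces.linear sV sT "\<lambda>x. \<tau> (v(Suc k := x))"
      using multilinear Suc.prems(1) by (auto simp: multilinear_map_def)
    have "\<tau> (v(Suc k := b)) \<in> ?S" if "b \<in> B" for b
      using that Suc.prems by (intro Suc.IH) auto
    then have "(\<lambda>x. \<tau> (v(Suc k := x))) ` V.span B \<subseteq> ?S"
      unfolding l.span_image[symmetric] by (intro T.span_minimal) auto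
    then have "\<tau> (v(Suc k := v (Suc k))) \<in> ?S" unfolding B by blast
    then show ?case by simp
  qed
  from this[of n] have "range \<tau> \<subseteq> ?S" by auto
  then have "T.span (range \<tau>) \<subseteq> ?S" by (intro T.span_minimal) auto
  then show ?thesis using span_pure by blast
qed

text \<open>Here \<open>h w x\<close> is the value at \<open>x\<close> and \<open>\<tau> w\<close> of the symmetric bilinear form for which the pure
  tensors of basis vectors are orthonormal; the operators of \<open>g\<close> and \<open>inv g\<close> are adjoint for it.\<close>

lemma adjoint_form:
  assumes dim: "finite B" "V.independent B" "V.span B = UNIV"
  obtains h :: "(nat \<Rightarrow> 'v) \<Rightarrow> 't \<Rightarrow> 'f"
  where "\<And>w. Vector_Spaces.linear sT (*) (h w)"
    and "\<And>g v w. g \<in> sym_group n \<Longrightarrow> h w (\<tau> (v \<circ> inv g)) = h v (\<tau> (w \<circ> g))"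
    and "\<And>x. (\<And>w. h w x = 0) \<Longrightarrow> x = 0"
proof -
  define r where "r = V.representation B"
  \<comment> \<open>The dot product in coordinates with respect to \<open>B\<close>. It is bilinear,
    with no conjugation over the complex numbers, which matches the linear extension of
    inversion.\<close>
  define \<beta> where "\<beta> x y = (\<Sum>b\<in>B. r x b * r y b)" for x y
  have r_add: "r (x + y) b = r x b + r y b" and r_scale: "r (sV c x) b = c * r x b" for x y b c
    using V.representation_add[OF dim(2), of y x] V.representation_scale[OF dim(2), of x c] dim(3)
    by (auto simp: r_def fun_eq_iff)
  have \<beta>_sym: "\<beta> x y = \<beta> y x" for x y by (simp add: \<beta>_def mult.commute)
  have \<beta>_add: "\<beta> (x + x') y = \<beta> x y + \<beta> x' y" and \<beta>_scale: "\<beta> (sV c x) y = c * \<beta> x y" for x x' y c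
    by (simp_all add: \<beta>_def r_add r_scale sum.distrib sum_distrib_left algebra_simps)
  have \<beta>_basis: "\<beta> x y = (if x = y then 1 else 0)" if "x \<in> B" "y \<in> B" for x y
    using that dim V.representation_basis[OF dim(2)]
    by (simp add: \<beta>_def r_def if_distrib[of "\<lambda>a. a * _"] sum.delta cong: if_cong)
  \<comment> \<open>The form on pure tensors; the universal property in the argument
    \<open>v\<close> yields the functional \<open>h w\<close>.\<close>
  define q where "q v w = (\<Prod>i\<in>{1..n}. \<beta> (v i) (w i))" for v w
  have q_sym: "q v w = q w v" for v w by (simp add: q_def \<beta>_sym)
  have "\<exists>h. Vector_Spaces.linear sT (*) h \<and> (\<forall>v. h (\<tau> v) = q v w)" for w
  proof -
    have "multilinear_map n sV (*) (\<lambda>v. q v w)"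
      unfolding multilinear_map_def
    proof (intro conjI allI ballI impI)
      fix v i assume i: "i \<in> {1..n}"
      have "q (v(i := x)) w = \<beta> x (w i) * (\<Prod>j\<in>{1..n} - {i}. \<beta> (v j) (w j))" for x
        unfolding q_def using i by (subst prod.remove[of _ i]) auto
      then show "Vector_Spaces.linear sV (*) (\<lambda>x. q (v(i := x)) w)"
        using V.vector_space_axioms vector_space_mult
        by (simp add: Vector_Spaces.linear_iff \<beta>_add \<beta>_scale algebra_simps)
    qed (simp add: q_def)
    then show ?thesis using universal_form by blast
  qed
  then obtain h where h: "\<And>w. Vector_Spaces.linear sT (*) (h w)" "\<And>w v. h w (\<tau> v) = q v w"
    by metis
  show ?thesis
  proof (rule that[of h])
    show "Vector_Spaces.linear sT (*) (h w)" for w by (rule h(1))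
    show "h w (\<tau> (v \<circ> inv g)) = h v (\<tau> (w \<circ> g))" if g: "g \<in> sym_group n" for g v w
    proof -
      have gp: "g permutes {1..n}" using g by (simp add: sym_group_def)
      \<comment> \<open>Reindexing the product over positions by \<open>g\<close> moves the
        permutation to the other argument.\<close>
      have "q (v \<circ> inv g) w = (\<Prod>i\<in>{1..n}. \<beta> (v (inv g (g i))) (w (g i)))"
        unfolding q_def by (subst prod.permute[OF gp]) (simp add: comp_def)
      also have "\<dots> = q v (w \<circ> g)"
        unfolding q_def by (simp add: permutes_inverses[OF gp])
      finally show ?thesis by (simp add: h(2) q_sym)
    qed
    fix x assume x: "\<And>w. h w x = 0"
    have fin: "finite ({1..n} \<rightarrow>\<^sub>E B)" using dim(1) by (intro finite_PiE) auto
    obtain c where c: "x = (\<Sum>v\<in>{1..n} \<rightarrow>\<^sub>E B. sT (c v) (\<tau> v))"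
      using T.span_image_finite[OF fin, of x \<tau>] span_pure_basis[OF dim(3)] by auto
    \<comment> \<open>Basis tensors are orthonormal, so \<open>h w x\<close> is the coefficient of
      \<open>x\<close> at \<open>w\<close>.\<close>
    have "c w = 0" if w: "w \<in> {1..n} \<rightarrow>\<^sub>E B" for w
    proof -
      interpret l: Vector_Spaces.linear sT "(*)" "h w" by (rule h(1))
      have q: "q v w = (if v = w then 1 else 0)" if v: "v \<in> {1..n} \<rightarrow>\<^sub>E B" for v
      proof (cases "v = w")
        case True
        have "\<beta> (w i) (w i) = 1" if "i \<in> {1..n}" for i
          using w that by (subst \<beta>_basis) auto
        then show ?thesis using True by (simp add: q_def)
      next
        case False
        then obtain i where "i \<in> {1..n}" "v i \<noteq> w i" using v w by (metis PiE_ext)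
        then have "\<beta> (v i) (w i) = 0" using v w by (subst \<beta>_basis) auto
        then show ?thesis using \<open>i \<in> {1..n}\<close> False by (auto simp: q_def intro!: prod_zero)
      qed
      have "h w x = (\<Sum>v\<in>{1..n} \<rightarrow>\<^sub>E B. c v * q v w)"
        by (simp add: c l.sum l.scale h(2))
      also have "\<dots> = (\<Sum>v\<in>{1..n} \<rightarrow>\<^sub>E B. if v = w then c v else 0)"
        by (intro sum.cong) (simp_all add: q)
      also have "\<dots> = c w" using fin w by simp
      finally show ?thesis using x by simp
    qed
    then show "x = 0" by (simp add: c)
  qed
qed

section \<open>Inversion on the algebra, spanning sets and bases\<close>

lemma linear_group_algebra_op: "Vector_Spaces.linear sT sT (group_algebra_op n sT \<tau> a)"
proof -
  interpret TT: vector_space_pair sT sT by unfold_locales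
  have "Vector_Spaces.linear sT sT (\<lambda>x. \<Sum>g\<in>sym_group n. sT (a g) (perm_op sT \<tau> g x))"
    by (intro TT.linear_compose_sum ballI TT.linear_compose_scale_right perm_op(1))
  moreover have "group_algebra_op n sT \<tau> a = (\<lambda>x. \<Sum>g\<in>sym_group n. sT (a g) (perm_op sT \<tau> g x))"
    by (simp add: group_algebra_op_def op_scale_def sum_fun_apply fun_eq_iff)
  ultimately show ?thesis by simp
qed

text \<open>The adjoint of zero is zero: moving each \<open>g\<close> across the form turns the
  image of \<open>a\<close> into that of \<open>\<lambda>g. a (inv g)\<close>, and the form
  separates points.\<close>

lemma group_algebra_op_inv_zero:
  assumes dim: "V.dim UNIV = 2" and zero: "group_algebra_op n sT \<tau> a = 0"
  shows "group_algebra_op n sT \<tau> (\<lambda>g. a (inv g)) = 0"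
proof -
  obtain B where B: "V.independent B" "V.span B = UNIV" "card B = 2"
    using V.basis_exists[of UNIV] dim by (metis UNIV_I subsetI subset_antisym)
  then have "finite B" using card.infinite by fastforce
  then obtain h where h: "\<And>w. Vector_Spaces.linear sT (*) (h w)"
    and adj: "\<And>g v w. g \<in> sym_group n \<Longrightarrow> h w (\<tau> (v \<circ> inv g)) = h v (\<tau> (w \<circ> g))"
    and sep: "\<And>x. (\<And>w. h w x = 0) \<Longrightarrow> x = 0"
    using adjoint_form[OF _ B(1,2)] by blast
  have h_op: "h w (group_algebra_op n sT \<tau> a (\<tau> v)) =
      (\<Sum>g\<in>sym_group n. a g * h w (\<tau> (v \<circ> inv g)))" for a w v
  proof -
    interpret l: Vector_Spaces.linear sT "(*)" "h w" by (rule h)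
    show ?thesis
      by (simp add: group_algebra_op_def op_scale_def sum_fun_apply l.sum l.scale perm_op(2))
  qed
  show ?thesis
  proof (rule linear_eq_pure[OF linear_group_algebra_op])
    show "Vector_Spaces.linear sT sT 0"
      by (simp add: Vector_Spaces.linear_iff T.vector_space_axioms)
    fix w
    have "h v (group_algebra_op n sT \<tau> (\<lambda>g. a (inv g)) (\<tau> w)) = 0" for v
    proof -
      interpret l: Vector_Spaces.linear sT "(*)" "h w" by (rule h)
      have "h v (group_algebra_op n sT \<tau> (\<lambda>g. a (inv g)) (\<tau> w)) =
        (\<Sum>g\<in>sym_group n. a (inv g) * h v (\<tau> (w \<circ> inv g)))" by (rule h_op)
      also have "\<dots> = (\<Sum>g\<in>sym_group n. a g * h v (\<tau> (w \<circ> g)))"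
        by (subst sum_sym_group_inv[symmetric])
          (intro sum.cong, auto simp: sym_group_def permutes_inv_inv)
      also have "\<dots> = h w (group_algebra_op n sT \<tau> a (\<tau> v))"
        unfolding h_op by (intro sum.cong) (simp_all add: adj)
      finally show ?thesis by (simp add: zero)
    qed
    then show "group_algebra_op n sT \<tau> (\<lambda>g. a (inv g)) (\<tau> w) = 0 (\<tau> w)"
      by (simp add: sep)
  qed
qed

text \<open>The coefficients picked by \<open>SOME\<close> differ from \<open>a\<close> by an
  element of the kernel, which inversion preserves.\<close>

lemma inverse_map_group_algebra_op:
  assumes dim: "V.dim UNIV = 2"
  shows "inverse_map n sT \<tau> (group_algebra_op n sT \<tau> a) = group_algebra_op n sT \<tau> (\<lambda>g. a (inv g))"
proof -
  define b where "b = (SOME b. group_algebra_op n sT \<tau> b = group_algebra_op n sT \<tau> a)"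
  have b: "group_algebra_op n sT \<tau> b = group_algebra_op n sT \<tau> a"
    unfolding b_def by (rule someI[of _ a]) simp
  have diff: "group_algebra_op n sT \<tau> (\<lambda>g. b g - a g) =
      group_algebra_op n sT \<tau> b - group_algebra_op n sT \<tau> a" for a b
    by (simp add: group_algebra_op_def op_scale_def T.scale_left_diff_distrib fun_eq_iff
        sum_fun_apply sum_subtractf)
  have "group_algebra_op n sT \<tau> (\<lambda>g. b (inv g) - a (inv g)) = 0"
    by (rule group_algebra_op_inv_zero[OF dim, of "\<lambda>g. b g - a g"]) (simp add: diff b)
  then have "group_algebra_op n sT \<tau> (\<lambda>g. b (inv g)) = group_algebra_op n sT \<tau> (\<lambda>g. a (inv g))"
    by (simp add: diff)
  then show ?thesis by (simp add: inverse_map_def b_def)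
qed

text \<open>The map \<open>\<iota>\<close> lets one argument serve several scalar fields: it will be
  the identity for the ground field and \<open>complex_of_real\<close> for real spans.\<close>

lemma special_span:
  fixes \<iota> :: "'k::field_char_0 \<Rightarrow> 'f"
  defines "s \<equiv> \<lambda>r. op_scale sT (\<iota> r)"
  assumes dim: "V.dim UNIV = 2" and s: "vector_space s"
  shows "module.span s (perm_op sT \<tau> ` special_perms n) =
    module.span s (perm_op sT \<tau> ` sym_group n)"
proof -
  interpret s: vector_space s by (rule s)
  have "perm_op sT \<tau> ` sym_group n \<subseteq> s.span (perm_op sT \<tau> ` special_perms n)"
    using special_perms_span[OF s alternating_relation_perm_op[OF dim]] by blast
  then show ?thesis
    using s.span_minimal[OF _ s.subspace_span] s.span_mono[OF image_mono[OF special_perms_subset]]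
    by (metis subset_antisym)
qed

lemma symmetric_span:
  fixes \<iota> :: "'k::field_char_0 \<Rightarrow> 'f"
  defines "s \<equiv> \<lambda>r. op_scale sT (\<iota> r)"
  assumes dim: "V.dim UNIV = 2" and s: "vector_space s"
  shows "{A \<in> module.span s (perm_op sT \<tau> ` sym_group n). inverse_map n sT \<tau> A = A} =
    module.span s (perm_op sT \<tau> ` {g. is_involution n g})"
proof -
  let ?P = "perm_op sT \<tau>"
  let ?I = "{g. is_involution n g}"
  note rel = alternating_relation_perm_op[OF dim]
  interpret trace_relation s "{1..n}" "\<lambda>css. ?P (perm_of css)"
    by (rule trace_relation_perm_of[OF s rel])
  have I: "?I \<subseteq> sym_group n" by (auto simp: is_involution_def)
  have inv: "inverse_map n sT \<tau> (\<Sum>g\<in>X. s (c g) (?P g)) = (\<Sum>g\<in>X. s (c g) (?P (inv g)))"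
    if X: "X \<subseteq> sym_group n" for X c
  proof -
    \<comment> \<open>Coefficients are extended by 0 outside \<open>X\<close> and carried over by
      \<open>\<iota>\<close>, so that a sum over \<open>X\<close> is the image of a group algebra
      element. Real combinations are thus complex ones with real coefficients.\<close>
    have sum: "(\<Sum>g\<in>sym_group n. op_scale sT (if g \<in> X then \<iota> (c g) else 0) (F g)) =
        (\<Sum>g\<in>X. s (c g) (F g))" for F
      using X finite_sym_group
      by (intro sum.mono_neutral_cong_right) (auto simp: s_def op_scale_def fun_eq_iff)
    have op: "(\<Sum>g\<in>X. s (c g) (?P g)) =
        group_algebra_op n sT \<tau> (\<lambda>g. if g \<in> X then \<iota> (c g) else 0)"
      unfolding group_algebra_op_def sum ..
    have "inverse_map n sT \<tau> (\<Sum>g\<in>X. s (c g) (?P g)) =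
        (\<Sum>g\<in>sym_group n. op_scale sT (if inv g \<in> X then \<iota> (c (inv g)) else 0) (?P g))"
      by (simp only: op inverse_map_group_algebra_op[OF dim]) (simp only: group_algebra_op_def)
    also have "\<dots> = (\<Sum>g\<in>sym_group n. op_scale sT (if g \<in> X then \<iota> (c g) else 0) (?P (inv g)))"
      by (subst sum_sym_group_inv[symmetric])
        (intro sum.cong, auto simp: sym_group_def permutes_inv_inv)
    finally show "inverse_map n sT \<tau> (\<Sum>g\<in>X. s (c g) (?P g)) = (\<Sum>g\<in>X. s (c g) (?P (inv g)))"
      unfolding sum .
  qed
  show ?thesis
  proof (intro subset_antisym subsetI)
    fix A assume A: "A \<in> {A \<in> span (?P ` sym_group n). inverse_map n sT \<tau> A = A}"
    then have "A \<in> span (?P ` special_perms n)"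
      unfolding special_span[OF dim s[unfolded s_def], folded s_def] by simp
    then obtain c where c: "A = (\<Sum>g\<in>special_perms n. s (c g) (?P g))"
      using span_image_finite[OF finite_subset[OF special_perms_subset finite_sym_group]] by blast
    have "A + A = A + inverse_map n sT \<tau> A" using A by simp
    also have "\<dots> = (\<Sum>g\<in>special_perms n. s (c g) (?P g + ?P (inv g)))"
      unfolding c inv[OF special_perms_subset] by (simp add: scale_right_distrib sum.distrib)
    also have "\<dots> \<in> span (?P ` ?I)"
      by (intro span_sum span_scale special_perm_add_inverse[OF s rel])
    finally show "A \<in> span (?P ` ?I)" by (rule half_mem[OF subspace_span])
  next
    fix A assume A: "A \<in> span (?P ` ?I)"
    obtain c where c: "A = (\<Sum>g\<in>?I. s (c g) (?P g))"
      using span_image_finite[OF finite_subset[OF I finite_sym_group] A] by blast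
    have "inverse_map n sT \<tau> A = A"
      unfolding c inv[OF I] by (intro sum.cong) (simp_all add: is_involution_inv)
    then show "A \<in> {A \<in> span (?P ` sym_group n). inverse_map n sT \<tau> A = A}"
      using A span_mono[OF image_mono[OF I], of ?P] by blast
  qed
qed

text \<open>Each of the two spanning sets contains a maximal independent subset; the choice is made
  among operators, so permutations with equal operators cause no repetition.\<close>

lemma bases_of_perm_ops:
  fixes \<iota> :: "'k::field_char_0 \<Rightarrow> 'f"
  defines "s \<equiv> \<lambda>r. op_scale sT (\<iota> r)"
  assumes dim: "V.dim UNIV = 2" and s: "vector_space s"
  shows "\<exists>B. B \<subseteq> perm_op sT \<tau> ` {g. is_special n g} \<and>
      is_basis s B (module.span s (perm_op sT \<tau> ` sym_group n))"
    and "\<exists>B. B \<subseteq> perm_op sT \<tau> ` {g. is_involution n g} \<and>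
      is_basis s B {A \<in> module.span s (perm_op sT \<tau> ` sym_group n). inverse_map n sT \<tau> A = A}"
proof -
  interpret s: vector_space s by (rule s)
  have basis: "\<exists>B. B \<subseteq> X \<and> is_basis s B (s.span X)" for X
  proof -
    obtain B where B: "B \<subseteq> X" "s.independent B" "X \<subseteq> s.span B"
      using s.maximal_independent_subset by blast
    then have "s.span B = s.span X"
      using s.span_mono[of B X] s.span_minimal[of X "s.span B"] by auto
    then show ?thesis using B by (auto simp: is_basis_def)
  qed
  have "perm_op sT \<tau> ` special_perms n \<subseteq> perm_op sT \<tau> ` {g. is_special n g}"
    using is_special_special_perms by blast
  then show "\<exists>B. B \<subseteq> perm_op sT \<tau> ` {g. is_special n g} \<and>
      is_basis s B (s.span (perm_op sT \<tau> ` sym_group n))"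
    using basis[of "perm_op sT \<tau> ` special_perms n"]
    unfolding special_span[OF dim s[unfolded s_def], folded s_def] by (meson subset_trans)
  show "\<exists>B. B \<subseteq> perm_op sT \<tau> ` {g. is_involution n g} \<and>
      is_basis s B {A \<in> s.span (perm_op sT \<tau> ` sym_group n). inverse_map n sT \<tau> A = A}"
    unfolding symmetric_span[OF dim s[unfolded s_def], folded s_def] by (rule basis)
qed

end

theorem theorem1p2:
  fixes n :: nat
    and sVQ :: "rat \<Rightarrow> 'v::ab_group_add \<Rightarrow> 'v"
    and sTQ :: "rat \<Rightarrow> 't::ab_group_add \<Rightarrow> 't"
    and \<tau>Q :: "(nat \<Rightarrow> 'v) \<Rightarrow> 't"
    and sVC :: "complex \<Rightarrow> 'w::ab_group_add \<Rightarrow> 'w"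
    and sTC :: "complex \<Rightarrow> 'u::ab_group_add \<Rightarrow> 'u"
    and \<tau>C :: "(nat \<Rightarrow> 'w) \<Rightarrow> 'u"
  assumes n: "n \<ge> 1"
  shows
    "(tensor_power n sVQ sTQ \<tau>Q \<and> vector_space.dim sVQ UNIV = 2 \<longrightarrow>
       (\<exists>B. B \<subseteq> perm_op sTQ \<tau>Q ` {g. is_special n g} \<and>
            is_basis (op_scale sTQ) B (perm_algebra n sTQ \<tau>Q)))
     \<and>
     (tensor_power n sVC sTC \<tau>C \<and> vector_space.dim sVC UNIV = 2 \<longrightarrow>
       (\<exists>B. B \<subseteq> perm_op sTC \<tau>C ` {g. is_special n g} \<and>
            is_basis (op_scale sTC) B (perm_algebra n sTC \<tau>C)) \<and>
       (\<exists>B. B \<subseteq> perm_op sTC \<tau>C ` {g. is_involution n g} \<and>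
            is_basis (op_scale sTC) B (symmetric_elements n sTC \<tau>C)) \<and>
       (\<exists>B. B \<subseteq> perm_op sTC \<tau>C ` {g. is_involution n g} \<and>
            is_basis (real_op_scale sTC) B (real_symmetric_elements n sTC \<tau>C)))"
proof (intro conjI impI; elim conjE)
  assume T: "tensor_power n sVQ sTQ \<tau>Q" and dim: "vector_space.dim sVQ UNIV = 2"
  interpret tensor_power n sVQ sTQ \<tau>Q by (rule T)
  show "\<exists>B. B \<subseteq> perm_op sTQ \<tau>Q ` {g. is_special n g} \<and>
      is_basis (op_scale sTQ) B (perm_algebra n sTQ \<tau>Q)"
    using bases_of_perm_ops(1)[of "\<lambda>x. x", OF dim] vector_space_op_scale[OF T.vector_space_axioms]
    by (simp add: perm_algebra_def)
next
  assume T: "tensor_power n sVC sTC \<tau>C" and dim: "vector_space.dim sVC UNIV = 2"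
  interpret tensor_power n sVC sTC \<tau>C by (rule T)
  note C = vector_space_op_scale[OF T.vector_space_axioms]
  show "\<exists>B. B \<subseteq> perm_op sTC \<tau>C ` {g. is_special n g} \<and>
      is_basis (op_scale sTC) B (perm_algebra n sTC \<tau>C)"
    using bases_of_perm_ops(1)[of "\<lambda>x. x", OF dim] C by (simp add: perm_algebra_def)
  show "\<exists>B. B \<subseteq> perm_op sTC \<tau>C ` {g. is_involution n g} \<and>
      is_basis (op_scale sTC) B (symmetric_elements n sTC \<tau>C)"
    using bases_of_perm_ops(2)[of "\<lambda>x. x", OF dim] C
    by (simp add: symmetric_elements_def perm_algebra_def)
  \<comment> \<open>Only the scalars change: they act through \<open>complex_of_real\<close>, while
    \<open>inverse_map\<close> stays the complex one.\<close>
  show "\<exists>B. B \<subseteq> perm_op sTC \<tau>C ` {g. is_involution n g} \<and>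
      is_basis (real_op_scale sTC) B (real_symmetric_elements n sTC \<tau>C)"
    using bases_of_perm_ops(2)[of complex_of_real, OF dim] vector_space_real_op_scale[OF T.vector_space_axioms]
    by (simp add: real_symmetric_elements_def real_elements_def real_op_scale_def[abs_def])
qed

end
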